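(* Total freeness does not imply the existence of a non-trivial universal derivation: there exist a field $\mathbb{K}$ of characteristic zero, an integer $\ell\ge 1$, and a totally free arrangement $\mathscr{A}$ in $V=\mathbb{K}^\ell$ such that for every multiplicity $m:\mathscr{A}\to\mathbb{Z}_{\ge 0}$ with $m\not\equiv 0$ there is no $m$-universal derivation $\theta\neq\theta_E$ in $D(\mathscr{A},m+\mathbf{1})$.
   Context: For a field $\mathbb{K}$ of characteristic zero and $V=\mathbb{K}^\ell$, let $S=\mathbb{K}[x_1,\ldots,x_\ell]$ and $\mathrm{Der}_S=\bigoplus_{i=1}^{\ell}S\,\partial_{x_i}$. A (central) arrangement $\mathscr{A}$ is a finite set of linear hyperplanes in $V$, assumed essential: $\bigcap_{H\in\mathscr{A}}H=\{0\}$ (so $\mathscr{A}\ne\emptyset$ as $\ell\ge 1$). For $H\in\mathscr{A}$ fix $\alpha_H\in V^*$ with $\ker\alpha_H=H$. A multiplicity is a map $m:\mathscr{A}\to\mathbb{Z}_{\ge 0}$; $\mathbf{1}$ is the multiplicity with constant value $1$. $D(\mathscr{A},m)=\{\theta\in\mathrm{Der}_S\mid\theta(\alpha_H)\in S\alpha_H^{m(H)}\ \forall H\in\mathscr{A}\}$. $(\mathscr{A},m)$ is free if $D(\mathscr{A},m)$ is a free $S$-module, and $\mathscr{A}$ is totally free if $(\mathscr{A},m)$ is free for every multiplicity $m:\mathscr{A}\to\mathbb{Z}_{\ge 0}$. A nonzero derivation $\theta$ is homogeneous of degree $k$ if every nonzero $\theta(\alpha)$, $\alpha\in V^*$, is a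 homogeneous polynomial of degree $k$. For $\varphi\in\mathrm{Der}_S$ and $\theta=\sum_i f_i\partial_{x_i}$ put $\nabla_\varphi\theta=\sum_i\varphi(f_i)\partial_{x_i}$. A homogeneous $\theta\in D(\mathscr{A},m+\mathbf{1})$ is $m$-universal if $\mathrm{Der}_S\to D(\mathscr{A},m)$, $\varphi\mapsto\nabla_\varphi\theta$, is an isomorphism of $S$-modules. $\theta_E=\sum_i x_i\partial_{x_i}$ is the Euler derivation. *)

theory Defs
  imports Complex_Main "HOL-Library.Poly_Mapping"
begin

text \<open>The field is a subfield \<open>K\<close> of an ambient field type of characteristic zero, and the
  dimension \<open>l\<close> is a natural number, so that both can be quantified inside a formula.\<close>

definition is_subfield :: "'k::field_char_0 set \<Rightarrow> bool" where
  "is_subfield K \<longleftrightarrow> 0 \<in> K \<and> 1 \<in> K \<and> (\<forall>a\<in>K. \<forall>b\<in>K. a - b \<in> K \<and> a * b \<in> K)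
     \<and> (\<forall>a\<in>K. inverse a \<in> K)"

text \<open>Vectors in \<open>K\<^sup>l\<close> are indexed by \<open>0, \<dots>, l - 1\<close> and extended by zero, which makes
  equality of functions the equality of vectors. The same convention is used for the
  coefficients of derivations below.\<close>

definition vecs :: "'k::field_char_0 set \<Rightarrow> nat \<Rightarrow> (nat \<Rightarrow> 'k) set" where
  "vecs K l = {v. (\<forall>i<l. v i \<in> K) \<and> (\<forall>i\<ge>l. v i = 0)}"

text \<open>A monomial is its exponent vector of type \<open>nat \<Rightarrow>\<^sub>0 nat\<close>, and \<open>'k mpoly\<close> is the
  polynomial ring in the variables \<open>x\<^sub>0, x\<^sub>1, \<dots>\<close> (with the convolution product of
  \<open>Poly_Mapping\<close>). The ring \<open>S\<close> over \<open>K\<close> in the first \<open>l\<close> variables is the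
  subset \<open>polys K l\<close>.\<close>

type_synonym 'k mpoly = "(nat \<Rightarrow>\<^sub>0 nat) \<Rightarrow>\<^sub>0 'k"

definition polys :: "'k::field_char_0 set \<Rightarrow> nat \<Rightarrow> 'k mpoly set" where
  "polys K l = {p. \<forall>t\<in>Poly_Mapping.keys p.
     Poly_Mapping.lookup p t \<in> K \<and> Poly_Mapping.keys t \<subseteq> {..<l}}"

definition pvar :: "nat \<Rightarrow> 'k::field_char_0 mpoly" where
  "pvar i = Poly_Mapping.single (Poly_Mapping.single i 1) 1"

definition pconst :: "'k \<Rightarrow> 'k::field_char_0 mpoly" where
  "pconst c = Poly_Mapping.single 0 c"

definition partial_deriv :: "nat \<Rightarrow> 'k::field_char_0 mpoly \<Rightarrow> 'k mpoly" where
  "partial_deriv i p = (\<Sum>t\<in>Poly_Mapping.keys p.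
     Poly_Mapping.single (t - Poly_Mapping.single i 1)
       (of_nat (Poly_Mapping.lookup t i) * Poly_Mapping.lookup p t))"

definition homogeneous_poly :: "nat \<Rightarrow> 'k::field_char_0 mpoly \<Rightarrow> bool" where
  "homogeneous_poly d p \<longleftrightarrow>
     (\<forall>t\<in>Poly_Mapping.keys p. (\<Sum>i\<in>Poly_Mapping.keys t. Poly_Mapping.lookup t i) = d)"

text \<open>An element of \<open>V\<^sup>*\<close> is given by its coefficient vector \<open>a \<in> vecs K l\<close>;
  \<open>linear_form l a\<close> is the corresponding polynomial, \<open>form_kernel K l a\<close> its kernel in
  \<open>V\<close>.\<close>

definition linear_form :: "nat \<Rightarrow> (nat \<Rightarrow> 'k::field_char_0) \<Rightarrow> 'k mpoly" where
  "linear_form l a = (\<Sum>i<l. pconst (a i) * pvar i)"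

definition form_kernel :: "'k::field_char_0 set \<Rightarrow> nat \<Rightarrow> (nat \<Rightarrow> 'k) \<Rightarrow> (nat \<Rightarrow> 'k) set" where
  "form_kernel K l a = {v \<in> vecs K l. (\<Sum>i<l. a i * v i) = 0}"

definition linear_hyperplane :: "'k::field_char_0 set \<Rightarrow> nat \<Rightarrow> (nat \<Rightarrow> 'k) set \<Rightarrow> bool" where
  "linear_hyperplane K l H \<longleftrightarrow> (\<exists>a\<in>vecs K l. a \<noteq> (\<lambda>_. 0) \<and> H = form_kernel K l a)"

text \<open>Intersecting with \<open>V\<close> makes the empty arrangement have intersection \<open>V\<close>.\<close>

definition essential_arrangement ::
  "'k::field_char_0 set \<Rightarrow> nat \<Rightarrow> (nat \<Rightarrow> 'k) set set \<Rightarrow> bool" where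
  "essential_arrangement K l A \<longleftrightarrow>
     finite A \<and> (\<forall>H\<in>A. linear_hyperplane K l H) \<and> vecs K l \<inter> \<Inter>A = {\<lambda>_. 0}"

definition alpha :: "'k::field_char_0 set \<Rightarrow> nat \<Rightarrow> (nat \<Rightarrow> 'k) set \<Rightarrow> 'k mpoly" where
  "alpha K l H = linear_form l (SOME a. a \<in> vecs K l \<and> form_kernel K l a = H)"

text \<open>The function \<open>\<theta>\<close> stands for \<open>\<Sum>\<^sub>i \<theta> i \<partial>\<^sub>i\<close>.\<close>

type_synonym 'k deriv = "nat \<Rightarrow> 'k mpoly"

definition Der :: "'k::field_char_0 set \<Rightarrow> nat \<Rightarrow> 'k deriv set" where
  "Der K l = {\<theta>. (\<forall>i<l. \<theta> i \<in> polys K l) \<and> (\<forall>i\<ge>l. \<theta> i = 0)}"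

definition der_apply :: "nat \<Rightarrow> 'k::field_char_0 deriv \<Rightarrow> 'k mpoly \<Rightarrow> 'k mpoly" where
  "der_apply l \<theta> p = (\<Sum>i<l. \<theta> i * partial_deriv i p)"

definition homogeneous_der :: "'k::field_char_0 set \<Rightarrow> nat \<Rightarrow> nat \<Rightarrow> 'k deriv \<Rightarrow> bool" where
  "homogeneous_der K l d \<theta> \<longleftrightarrow> \<theta> \<noteq> (\<lambda>_. 0) \<and>
     (\<forall>a\<in>vecs K l. der_apply l \<theta> (linear_form l a) \<noteq> 0 \<longrightarrow>
        homogeneous_poly d (der_apply l \<theta> (linear_form l a)))"

definition euler_der :: "nat \<Rightarrow> 'k::field_char_0 deriv" where
  "euler_der l = (\<lambda>i. if i < l then pvar i else 0)"

definition nabla :: "nat \<Rightarrow> 'k::field_char_0 deriv \<Rightarrow> 'k deriv \<Rightarrow> 'k deriv" where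
  "nabla l \<phi> \<theta> = (\<lambda>i. der_apply l \<phi> (\<theta> i))"

text \<open>A multiplicity is a function on all sets of vectors; only its values on \<open>A\<close> matter.\<close>

definition multi_der :: "'k::field_char_0 set \<Rightarrow> nat \<Rightarrow> (nat \<Rightarrow> 'k) set set \<Rightarrow>
    ((nat \<Rightarrow> 'k) set \<Rightarrow> nat) \<Rightarrow> 'k deriv set" where
  "multi_der K l A m = {\<theta> \<in> Der K l.
     \<forall>H\<in>A. \<exists>q\<in>polys K l. der_apply l \<theta> (alpha K l H) = q * alpha K l H ^ m H}"

text \<open>Submodules \<open>M\<close> of a power of a ring, where the ring of scalars is the subring \<open>S\<close>.\<close>

definition module_basis :: "'r::comm_ring_1 set \<Rightarrow> (nat \<Rightarrow> 'r) set \<Rightarrow> (nat \<Rightarrow> 'r) set \<Rightarrow> bool" where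
  "module_basis S M B \<longleftrightarrow> B \<subseteq> M
     \<and> (\<forall>\<theta>\<in>M. \<exists>F c. finite F \<and> F \<subseteq> B \<and> (\<forall>b\<in>F. c b \<in> S) \<and> \<theta> = (\<lambda>i. \<Sum>b\<in>F. c b * b i))
     \<and> (\<forall>F c. finite F \<and> F \<subseteq> B \<and> (\<forall>b\<in>F. c b \<in> S) \<and> (\<lambda>i. \<Sum>b\<in>F. c b * b i) = (\<lambda>_. 0)
           \<longrightarrow> (\<forall>b\<in>F. c b = 0))"

definition free_module :: "'r::comm_ring_1 set \<Rightarrow> (nat \<Rightarrow> 'r) set \<Rightarrow> bool" where
  "free_module S M \<longleftrightarrow> (\<exists>B. module_basis S M B)"

definition module_iso :: "'r::comm_ring_1 set \<Rightarrow> (nat \<Rightarrow> 'r) set \<Rightarrow> (nat \<Rightarrow> 'r) set \<Rightarrow>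
    ((nat \<Rightarrow> 'r) \<Rightarrow> (nat \<Rightarrow> 'r)) \<Rightarrow> bool" where
  "module_iso S M N f \<longleftrightarrow> bij_betw f M N
     \<and> (\<forall>u\<in>M. \<forall>v\<in>M. f (\<lambda>i. u i + v i) = (\<lambda>i. f u i + f v i))
     \<and> (\<forall>s\<in>S. \<forall>u\<in>M. f (\<lambda>i. s * u i) = (\<lambda>i. s * f u i))"

definition free_multiarrangement :: "'k::field_char_0 set \<Rightarrow> nat \<Rightarrow> (nat \<Rightarrow> 'k) set set \<Rightarrow>
    ((nat \<Rightarrow> 'k) set \<Rightarrow> nat) \<Rightarrow> bool" where
  "free_multiarrangement K l A m \<longleftrightarrow> free_module (polys K l) (multi_der K l A m)"

definition totally_free :: "'k::field_char_0 set \<Rightarrow> nat \<Rightarrow> (nat \<Rightarrow> 'k) set set \<Rightarrow> bool" where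
  "totally_free K l A \<longleftrightarrow> (\<forall>m. free_multiarrangement K l A m)"

definition universal_der :: "'k::field_char_0 set \<Rightarrow> nat \<Rightarrow> (nat \<Rightarrow> 'k) set set \<Rightarrow>
    ((nat \<Rightarrow> 'k) set \<Rightarrow> nat) \<Rightarrow> 'k deriv \<Rightarrow> bool" where
  "universal_der K l A m \<theta> \<longleftrightarrow>
     \<theta> \<in> multi_der K l A (\<lambda>H. m H + 1) \<and> (\<exists>d. homogeneous_der K l d \<theta>)
     \<and> module_iso (polys K l) (Der K l) (multi_der K l A m) (\<lambda>\<phi>. nabla l \<phi> \<theta>)"

end

theory Submission
  imports Defs "HOL-Computational_Algebra.Computational_Algebra"
    "HOL-Analysis.Continuum_Not_Denumerable"
begin

text \<open>
  The arrangement consists of four lines $x_0 = z x_1$ with $z \in Z = \{0, 1, 2, x\}$ in the plane over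
  $\mathbb{K} = \mathbb{Q}(x)$, where $x$ is transcendental. It is totally free because every plane
  multiarrangement is free (\<open>plane_multi_der_basis\<close>).

  Suppose that $\theta = f \partial_0 + g \partial_1$ of degree $d$ is $m$-universal. Then $f/g$ is a rational
  self-map of the projective line that fixes the four points of $Z$ and whose ramification is
  concentrated at these points, with multiplicities $m$; write $|m|$ for their sum. In the affine coordinate the Wronskian of
  $f$ and $g$ is a constant times $\prod_{z} (\zeta - z)^{m_z}$, and a degree count gives
  $d - 1 \le |m| - m_z$ for each $z$ (\<open>universal_der_univariate\<close>). So $m \ne 0$ implies
  $|m| \ge d$.

  Such maps are rigid, so they do not exist over a transcendental cross-ratio. The proof of rigidity
  used here is algebraic. Clear denominators and replace $x$ by a variable $t$, so that $f, g$ have coefficients in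
  $\mathbb{Z}[t]$. For two points put $D(p,q) = f(p)g(q) - g(p)f(q)$; the fixed point equations give
  $D(p,q) = (p - q)\, g(p) g(q)$. In characteristic zero a vanishing Wronskian means linear dependence.
  Hence a basis change of the lattice spanned by $f, g$ shows that every polynomial in $t$ dividing the Wronskian
  divides all $D(p,q)$ (\<open>dvd_wronskian_imp_dvd_cross_det\<close>), with an analogous degree bound at
  $t = \infty$ (\<open>degree_cross_det_le\<close>). Where $t$ meets a fixed point $z$, rescaling gives an extra
  divisibility of $D(z,t)$ (\<open>dvd_cross_det_moving_point\<close>). Comparing the zeros of
  $g(0)\, g(1)\, g(2)\, g(t)$ with its degree yields $|m| < d$
  (\<open>fixed_ramification_bound\<close>), a contradiction.
\<close>

section \<open>Wronskians\<close>

text \<open>For two binary forms $F, G$ of degree $d$ in $x, y$, written in the affine coordinate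
  $z = x/y$, the polynomial $f'g - fg'$ is $1/d$ times their Jacobian determinant.\<close>

definition wronskian :: "'a::idom poly \<Rightarrow> 'a poly \<Rightarrow> 'a poly" where
  "wronskian f g = pderiv f * g - f * pderiv g"

lemma wronskian_swap: "wronskian g f = - wronskian f g"
  by (simp add: wronskian_def algebra_simps)

lemma wronskian_combine_right:
  "wronskian f (smult a f + smult b g) = smult b (wronskian f g)"
  by (simp add: wronskian_def pderiv_add pderiv_smult algebra_simps smult_diff_right)

lemma wronskian_combine_left:
  "wronskian (smult a f + smult b g) g = smult a (wronskian f g)"
  by (simp add: wronskian_def pderiv_add pderiv_smult algebra_simps smult_diff_right)

lemma wronskian_eq_0_imp_degree_eq:
  fixes f g :: "'a::{idom,semiring_char_0} poly"
  assumes "wronskian f g = 0" "f \<noteq> 0" "g \<noteq> 0"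
  shows "degree f = degree g"
proof -
  have eq: "pderiv f * g = f * pderiv g" using assms(1) by (simp add: wronskian_def)
  have lc: "lead_coeff (pderiv p) = of_nat (degree p) * lead_coeff p" for p :: "'a poly"
    by (cases "degree p") (auto simp: coeff_pderiv degree_pderiv coeff_eq_0)
  from eq have "lead_coeff (pderiv f * g) = lead_coeff (f * pderiv g)" by simp
  then have "of_nat (degree f) * (lead_coeff f * lead_coeff g) 
      = of_nat (degree g) * (lead_coeff f * lead_coeff g)"
    unfolding lead_coeff_mult lc by (simp add: algebra_simps)
  then show ?thesis using assms by simp
qed

text \<open>Subtracting multiples equalises leading terms: a Wronskian that vanishes forces equal degrees,
  and $\mathrm{lc}(g) f - \mathrm{lc}(f) g$ has too small a degree unless it is zero.\<close>

lemma wronskian_eq_0_imp_dependent: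
  fixes f g :: "'a::{idom,semiring_char_0} poly"
  assumes "wronskian f g = 0"
  obtains a b where "a \<noteq> 0 \<or> b \<noteq> 0" "smult a f + smult b g = 0"
proof (cases "f = 0 \<or> g = 0")
  case True
  then show ?thesis using that[of 1 0] that[of 0 1] by auto
next
  case False
  define h where "h = smult (lead_coeff g) f + smult (- lead_coeff f) g"
  have deg: "degree f = degree g"
    using wronskian_eq_0_imp_degree_eq[OF assms] False by blast
  have "h = 0"
  proof (rule ccontr)
    assume "h \<noteq> 0"
    have "wronskian h g = 0"
      unfolding h_def wronskian_combine_left using assms by simp
    then have "degree h = degree g"
      using wronskian_eq_0_imp_degree_eq False \<open>h \<noteq> 0\<close> by blast
    then have "lead_coeff h = 0" by (simp add: h_def deg)
    then show False using \<open>h \<noteq> 0\<close> by simp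
  qed
  then show ?thesis using that[of "lead_coeff g" "- lead_coeff f"] False
    by (auto simp: h_def)
qed

text \<open>The determinant of the two vectors $(F,G)(P)$ and $(F,G)(Q)$ in the plane. An invertible
  constant change of $(F,G)$ multiplies it and the Wronskian by the same factor.\<close>

definition cross_det :: "'a::comm_ring_1 poly \<Rightarrow> 'a poly \<Rightarrow> 'a \<Rightarrow> 'a \<Rightarrow> 'a" where
  "cross_det F G P Q = poly F P * poly G Q - poly G P * poly F Q"

lemma cross_det_swap: "cross_det G F P Q = - cross_det F G P Q"
  by (simp add: cross_det_def)

lemma cross_det_combine_right:
  "cross_det F (smult a F + smult b G) P Q = b * cross_det F G P Q"
  by (simp add: cross_det_def algebra_simps)

lemma cross_det_combine_left:
  "cross_det (smult a F + smult b G) G P Q = a * cross_det F G P Q"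
  by (simp add: cross_det_def algebra_simps)

lemma map_poly_hom_mult:
  fixes h :: "'a::comm_semiring_0 \<Rightarrow> 'b::comm_semiring_0"
  assumes h0: "h 0 = 0" and ha: "\<And>x y. h (x + y) = h x + h y"
    and hm: "\<And>x y. h (x * y) = h x * h y"
  shows "map_poly h (p * q) = map_poly h p * map_poly h q"
proof -
  have hs: "h (sum u A) = (\<Sum>x\<in>A. h (u x))" for u :: "nat \<Rightarrow> 'a" and A
    by (induction A rule: infinite_finite_induct) (auto simp: h0 ha)
  show ?thesis by (rule poly_eqI) (simp add: coeff_map_poly h0 coeff_mult hs hm)
qed

lemma wronskian_map_poly:
  fixes h :: "'a::idom \<Rightarrow> 'b::idom"
  assumes h0: "h 0 = 0" and h1: "h 1 = 1" and ha: "\<And>x y. h (x + y) = h x + h y"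
    and hm: "\<And>x y. h (x * y) = h x * h y"
  shows "wronskian (map_poly h f) (map_poly h g) = map_poly h (wronskian f g)"
proof -
  have hn: "h (of_nat n) = of_nat n" for n by (induction n) (auto simp: h0 h1 ha)
  have hd: "h (x - y) = h x - h y" for x y
    using ha[of "x - y" y] by (simp add: algebra_simps)
  have mult: "map_poly h (p * q) = map_poly h p * map_poly h q" for p q
    by (rule map_poly_hom_mult) (fact h0 ha hm)+
  have der: "map_poly h (pderiv p) = pderiv (map_poly h p)" for p
    by (rule poly_eqI) (simp add: coeff_map_poly h0 coeff_pderiv hm hn ha h1)
  have diff: "map_poly h (p - q) = map_poly h p - map_poly h q" for p q
    by (rule poly_eqI) (simp add: coeff_map_poly h0 hd)
  show ?thesis by (simp add: wronskian_def mult der diff)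
qed

text \<open>The coefficients lie in $\mathbb{C}[t]$. If $t - r$ divides the Wronskian, then at $t = r$ the
  two polynomials become linearly dependent, because the residue field has characteristic zero. Hence
  some constant combination of $F$ and $G$ is divisible by $t - r$, and dividing it out removes one
  factor $t - r$ from the Wronskian and from the determinant.\<close>

lemma dvd_wronskian_imp_dvd_cross_det:
  fixes F G :: "complex poly poly" and N :: "complex poly"
  assumes "[:N:] dvd wronskian F G"
  shows "N dvd cross_det F G P Q"
  using assms
proof (induction "degree N" arbitrary: N F G)
  case 0
  then obtain c where N: "N = [:c:]" by (metis degree_eq_zeroE)
  show ?case
  proof (cases "c = 0")
    case True
    then have "wronskian F G = 0" using 0 N by simp
    then obtain a b where ab: "a \<noteq> 0 \<or> b \<noteq> 0" "smult a F + smult b G = 0"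
      by (rule wronskian_eq_0_imp_dependent)
    have "b * cross_det F G P Q = 0" "a * cross_det F G P Q = 0"
      using cross_det_combine_right[of F a b G P Q] cross_det_combine_left[of a F b G P Q] ab(2)
      by (simp_all add: cross_det_def)
    then show ?thesis using ab(1) by auto
  next
    case False
    then show ?thesis unfolding N by (simp add: is_unit_const_poly_iff unit_imp_dvd dvd_field_iff)
  qed
next
  case (Suc n)
  then have "\<not> constant (poly N)" by (simp add: constant_degree)
  then obtain r where "poly N r = 0" using fundamental_theorem_of_algebra by blast
  then obtain N' where N: "N = [:-r, 1:] * N'" by (metis poly_eq_0_iff_dvd dvdE)
  have "N' \<noteq> 0" using N Suc.hyps(2) by auto
  then have N': "n = degree N'" using Suc.hyps(2) unfolding N by (subst (asm) degree_mult_eq) auto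
  \<comment> \<open>specialisation of the coefficients at the root $r$ of $N$\<close>
  define h where "h = (\<lambda>p :: complex poly. poly p r)"
  have h0: "h 0 = 0" by (simp add: h_def)
  have dvdI: "\<exists>E. H = smult [:-r, 1:] E" if "map_poly h H = 0" for H
  proof -
    have "[:[:-r, 1:]:] dvd H" unfolding const_poly_dvd_iff
    proof
      fix k
      have "h (coeff H k) = 0" using that by (metis coeff_map_poly coeff_0 h0)
      then show "[:-r, 1:] dvd coeff H k" by (simp add: h_def poly_eq_0_iff_dvd)
    qed
    then show ?thesis by (auto elim!: dvdE)
  qed
  obtain V where V: "wronskian F G = smult N V" using Suc.prems by (auto elim!: dvdE)
  have "wronskian (map_poly h F) (map_poly h G) = map_poly h (wronskian F G)"
    by (rule wronskian_map_poly) (simp_all add: h_def)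
  also have "\<dots> = 0" unfolding V by (rule poly_eqI) (simp add: coeff_map_poly h_def N)
  finally obtain a b where ab: "a \<noteq> 0 \<or> b \<noteq> 0" "smult a (map_poly h F) + smult b (map_poly h G) = 0"
    by (rule wronskian_eq_0_imp_dependent)
  have "map_poly h (smult [:a:] F + smult [:b:] G) = smult a (map_poly h F) + smult b (map_poly h G)"
    by (rule poly_eqI) (simp add: coeff_map_poly h_def)
  then obtain E where E: "smult [:a:] F + smult [:b:] G = smult [:-r, 1:] E"
    using dvdI ab(2) by metis
  have step: "N dvd cross_det F G P Q"
    if V: "wronskian F G = smult N V" and E: "smult [:a:] F + smult [:b:] G = smult [:-r, 1:] E"
      and "b \<noteq> 0" for F G E V a b
  proof -
    have "smult [:-r, 1:] (wronskian F E) = smult [:b:] (smult N V)"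
      using wronskian_combine_right[of F "[:a:]" "[:b:]" G] wronskian_combine_right[of F 0 "[:-r, 1:]" E]
      unfolding V E by simp
    then have "smult [:-r, 1:] (wronskian F E) = smult [:-r, 1:] (smult [:b:] (smult N' V))"
      by (simp only: N smult_smult mult_ac)
    then have "wronskian F E = smult [:b:] (smult N' V)"
      by (metis smult_cancel pCons_eq_0_iff one_neq_zero)
    then have "[:N':] dvd wronskian F E" by (simp add: const_poly_dvd_iff dvd_smult)
    then have "N' dvd cross_det F E P Q" using Suc.hyps(1) N' by blast
    moreover have "[:b:] * cross_det F G P Q = [:-r, 1:] * cross_det F E P Q"
      using cross_det_combine_right[of F "[:a:]" "[:b:]" G P Q] cross_det_combine_right[of F 0 "[:-r, 1:]" E P Q]
      unfolding E by simp
    ultimately have "[:-r, 1:] * N' dvd [:b:] * cross_det F G P Q"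
      by (metis mult_dvd_mono dvd_refl)
    then have "N dvd smult b (cross_det F G P Q)" unfolding N by simp
    then show ?thesis using \<open>b \<noteq> 0\<close> by (simp add: dvd_smult_iff)
  qed
  from ab(1) show ?case
  proof
    assume "b \<noteq> 0"
    then show ?case by (rule step[OF V E])
  next
    assume "a \<noteq> 0"
    moreover have "wronskian G F = smult N (- V)" using V by (simp add: wronskian_swap[of G F])
    moreover have "smult [:b:] G + smult [:a:] F = smult [:-r, 1:] E" using E by (simp add: add.commute)
    ultimately have "N dvd cross_det G F P Q" by (intro step)
    then show ?case by (simp add: cross_det_swap[of F G])
  qed
qed

section \<open>Degrees in the parameter\<close>

lemma coeff_mult_at_degree_bound:
  fixes p q :: "'a::comm_semiring_0 poly"
  assumes "degree p \<le> a" "degree q \<le> b"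
  shows "coeff (p * q) (a + b) = coeff p a * coeff q b"
proof (cases "degree p = a \<and> degree q = b")
  case True
  then show ?thesis using coeff_mult_degree_sum[of p q] by simp
next
  case False
  then have lt: "degree p < a \<or> degree q < b" using assms by auto
  then have "degree (p * q) < a + b"
    using degree_mult_le[of p q] assms by linarith
  then show ?thesis using lt by (auto simp: coeff_eq_0)
qed

lemma degree_poly_le:
  fixes F :: "'a::comm_semiring_1 poly poly"
  assumes "\<And>i. degree (coeff F i) \<le> a" "degree P \<le> e" "degree F \<le> d"
  shows "degree (poly F P) \<le> a + e * d"
proof -
  have "degree (coeff F i * P ^ i) \<le> a + e * d" if "i \<le> degree F" for i
  proof -
    have "degree (P ^ i) \<le> degree P * i" by (rule degree_power_le)
    also have "\<dots> \<le> e * d" using that assms by (intro mult_mono) auto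
    finally show ?thesis using degree_mult_le[of "coeff F i" "P ^ i"] assms(1)[of i] by linarith
  qed
  then show ?thesis unfolding poly_altdef by (intro degree_sum_le) auto
qed

lemma coeff_wronskian_top:
  fixes F G :: "'a::idom poly poly"
  assumes F: "\<And>i. degree (coeff F i) \<le> a" and G: "\<And>i. degree (coeff G i) \<le> b"
  shows "wronskian (map_poly (\<lambda>p. coeff p a) F) (map_poly (\<lambda>p. coeff p b) G)
       = map_poly (\<lambda>p. coeff p (a + b)) (wronskian F G)"
proof -
  have mult: "map_poly (\<lambda>p. coeff p (a + b)) (p * q) 
      = map_poly (\<lambda>p. coeff p a) p * map_poly (\<lambda>p. coeff p b) q"
    if "\<And>i. degree (coeff p i) \<le> a" "\<And>i. degree (coeff q i) \<le> b" for p q :: "'a poly poly"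
    using that
    by (intro poly_eqI) (simp add: coeff_map_poly coeff_mult[of p q] coeff_sum 
        coeff_mult_at_degree_bound coeff_mult[of "map_poly _ p" "map_poly _ q"])
  have of_nat: "of_nat n * p = smult (of_nat n) p" for n and p :: "'a poly"
    by (simp add: of_nat_poly)
  have der: "map_poly (\<lambda>p. coeff p m) (pderiv p) = pderiv (map_poly (\<lambda>p. coeff p m) p)" for m and p :: "'a poly poly"
    by (rule poly_eqI) (simp add: coeff_map_poly coeff_pderiv of_nat del: of_nat_Suc)
  have diff: "map_poly (\<lambda>p. coeff p m) (p - q) = map_poly (\<lambda>p. coeff p m) p - map_poly (\<lambda>p. coeff p m) q" 
    for m and p q :: "'a poly poly"
    by (rule poly_eqI) (simp add: coeff_map_poly)
  have ddeg: "degree (coeff (pderiv p) i) \<le> m" if "\<And>i. degree (coeff p i) \<le> m" for m i and p :: "'a poly poly"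
    unfolding coeff_pderiv of_nat using that by (meson degree_smult_le order_trans)
  show ?thesis
    using F G by (simp add: wronskian_def diff mult der ddeg)
qed

text \<open>The analogue at the place $t = \infty$ of the divisibility of \<open>cross_det\<close> by a divisor of the
  Wronskian. As long as the sum $a + b$ of the bounds on the $t$-degrees of $F$ and $G$ exceeds the bound
  $k$ for the Wronskian, the coefficients of $t^a$ in $F$ and of $t^b$ in $G$ are linearly dependent, and a
  combination of $F$ and $G$ has a smaller $t$-degree. The determinant changes only by a nonzero
  constant.\<close>

lemma degree_cross_det_le:
  fixes F G :: "complex poly poly"
  assumes "wronskian F G \<noteq> 0" and "\<And>i. degree (coeff (wronskian F G) i) \<le> k"
    and "\<And>i. degree (coeff F i) \<le> a" and "\<And>i. degree (coeff G i) \<le> b"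
    and "degree F \<le> d" and "degree G \<le> d" and "degree P = 0" and "degree Q \<le> e"
  shows "degree (cross_det F G P Q) \<le> k + e * d"
  using assms
proof (induction "a + b" arbitrary: a b F G rule: less_induct)
  case (less a b F G)
  \<comment> \<open>One descent step, stated for the case that $F$ has the smaller bound so that it serves both orders.\<close>
  have reduce: "degree (cross_det F G P Q) \<le> k + e * d"
    if IH: "\<And>a' b' F' G'. \<lbrakk>a' + b' < a + b; wronskian F' G' \<noteq> 0; 
        \<And>i. degree (coeff (wronskian F' G') i) \<le> k; \<And>i. degree (coeff F' i) \<le> a'; 
        \<And>i. degree (coeff G' i) \<le> b'; degree F' \<le> d; degree G' \<le> d\<rbrakk> 
        \<Longrightarrow> degree (cross_det F' G' P Q) \<le> k + e * d"
      and W: "wronskian F G \<noteq> 0" "\<And>i. degree (coeff (wronskian F G) i) \<le> k"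
      and F: "\<And>i. degree (coeff F i) \<le> a" and G: "\<And>i. degree (coeff G i) \<le> b"
      and d: "degree F \<le> d" "degree G \<le> d" 
      and "a \<le> b" and "k < a + b"
    for a b F G
  proof -
    have "wronskian (map_poly (\<lambda>p. coeff p a) F) (map_poly (\<lambda>p. coeff p b) G) = 0"
      unfolding coeff_wronskian_top[OF F G]
    proof (rule poly_eqI)
      fix i
      have "degree (coeff (wronskian F G) i) < a + b" using W(2)[of i] \<open>k < a + b\<close> by linarith
      then show "coeff (map_poly (\<lambda>p. coeff p (a + b)) (wronskian F G)) i = coeff 0 i"
        by (simp add: coeff_map_poly coeff_eq_0)
    qed
    then obtain u v where uv: "u \<noteq> 0 \<or> v \<noteq> 0"
      "smult u (map_poly (\<lambda>p. coeff p a) F) + smult v (map_poly (\<lambda>p. coeff p b) G) = 0"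
      by (rule wronskian_eq_0_imp_dependent)
    have top: "u * coeff (coeff F i) a + v * coeff (coeff G i) b = 0" for i
    proof -
      have "coeff (smult u (map_poly (\<lambda>p. coeff p a) F) + smult v (map_poly (\<lambda>p. coeff p b) G)) i = 0"
        unfolding uv(2) by simp
      then show ?thesis by (simp add: coeff_map_poly)
    qed
    have drop: "degree p \<le> m - 1" if "degree p \<le> m" "coeff p m = 0" for p :: "complex poly" and m
      using that by (metis One_nat_def Suc_pred coeff_0_degree_minus_1 degree_0 diff_is_0_eq' 
          le_less_Suc_eq leading_coeff_0_iff not_le zero_le)
    show ?thesis
    proof (cases "v = 0")
      case True
      then have top0: "coeff (coeff F i) a = 0" for i using top[of i] uv(1) by simp
      have "a \<noteq> 0"
      proof
        assume "a = 0"
        then have "coeff F i = 0" for i using F[of i] top0[of i] by (metis le_0_eq leading_coeff_0_iff)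
        then have "F = 0" by (simp add: poly_eqI)
        then show False using W(1) by (simp add: wronskian_def)
      qed
      then show ?thesis
        by (intro IH[of "a - 1" b F G] W F G d drop top0) auto
    next
      case False
      define G' where "G' = smult (monom u (b - a)) F + smult [:v:] G"
      have W': "wronskian F G' = smult [:v:] (wronskian F G)"
        unfolding G'_def by (rule wronskian_combine_right)
      have "degree (coeff G' i) \<le> b - 1" for i
      proof (rule drop)
        have "degree (monom u (b - a) * coeff F i) \<le> (b - a) + a"
          by (rule order_trans[OF degree_mult_le add_mono[OF degree_monom_le F]])
        then show "degree (coeff G' i) \<le> b"
          unfolding G'_def using G[of i] \<open>a \<le> b\<close> degree_smult_le[of v "coeff G i"] 
          by (auto intro!: degree_add_le)
        have "coeff (monom u (b - a) * coeff F i) b = u * coeff (coeff F i) a"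
          using coeff_monom_mult[of u "b - a" "coeff F i" b] \<open>a \<le> b\<close> by simp
        then show "coeff (coeff G' i) b = 0" unfolding G'_def using top[of i] by simp
      qed
      moreover have "degree G' \<le> d"
        unfolding G'_def using d by (meson degree_add_le degree_smult_le order_trans)
      moreover have "degree (coeff (wronskian F G') i) \<le> k" for i
        unfolding W' using W(2)[of i] False by simp
      moreover have "wronskian F G' \<noteq> 0" unfolding W' using W(1) False by simp
      ultimately have "degree (cross_det F G' P Q) \<le> k + e * d"
        using \<open>a \<le> b\<close> \<open>k < a + b\<close> F d by (intro IH[of a "b - 1" F G']) auto
      moreover have "cross_det F G' P Q = smult v (cross_det F G P Q)"
        unfolding G'_def cross_det_combine_right by simp
      ultimately show ?thesis using False by simp
    qed
  qed
  consider "a + b \<le> k" | "k < a + b" "a \<le> b" | "k < a + b" "b \<le> a" by linarith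
  then show ?case
  proof cases
    case 1
    have P: "degree P \<le> 0" using less.prems by simp
    have "degree (poly F P * poly G Q) \<le> (a + 0 * d) + (b + e * d)"
      using less.prems P by (intro order_trans[OF degree_mult_le add_mono] degree_poly_le) auto
    moreover have "degree (poly G P * poly F Q) \<le> (b + 0 * d) + (a + e * d)"
      using less.prems P by (intro order_trans[OF degree_mult_le add_mono] degree_poly_le) auto
    ultimately show ?thesis unfolding cross_det_def using 1 by (intro degree_diff_le) auto
  next
    case 2
    show ?thesis 
      by (rule reduce[of a b F G]) (use less.prems 2 in \<open>auto intro!: less.hyps\<close>)
  next
    case 3
    have "degree (cross_det G F P Q) \<le> k + e * d"
    proof (rule reduce[of b a G F])
      fix a' b' :: nat and F' G' :: "complex poly poly"
      assume "a' + b' < b + a" "wronskian F' G' \<noteq> 0" 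
        "\<And>i. degree (coeff (wronskian F' G') i) \<le> k" "\<And>i. degree (coeff F' i) \<le> a'"
        "\<And>i. degree (coeff G' i) \<le> b'" "degree F' \<le> d" "degree G' \<le> d"
      then show "degree (cross_det F' G' P Q) \<le> k + e * d"
        using less.prems(7,8) by (intro less.hyps[of a' b' F' G']) auto
    qed (use less.prems 3 in \<open>auto simp: wronskian_swap[of F G]\<close>)
    then show ?thesis by (simp add: cross_det_swap[of F G])
  qed
qed

section \<open>Maps ramified only at fixed points\<close>

lemma degree_coeff_mult_le:
  fixes p q :: "'a::comm_semiring_0 poly poly"
  assumes "\<And>i. degree (coeff p i) \<le> a" "\<And>i. degree (coeff q i) \<le> b"
  shows "degree (coeff (p * q) i) \<le> a + b"
  unfolding coeff_mult using assms
  by (intro degree_sum_le) (auto intro!: order_trans[OF degree_mult_le] add_mono)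

lemma degree_coeff_power_le:
  fixes p :: "'a::comm_semiring_1 poly poly"
  assumes "\<And>i. degree (coeff p i) \<le> a"
  shows "degree (coeff (p ^ n) i) \<le> n * a"
proof (induction n arbitrary: i)
  case 0
  then show ?case by (cases "i = 0") auto
next
  case (Suc n)
  then show ?case using degree_coeff_mult_le[of p a "p ^ n" "n * a" i] assms by simp
qed

lemma sum_order_le_degree:
  fixes p :: "'a::idom poly"
  assumes "p \<noteq> 0" "finite A"
  shows "(\<Sum>a\<in>A. order a p) \<le> degree p"
proof -
  have "(\<Sum>a\<in>A. count (proots p) a) = (\<Sum>a\<in>A \<inter> set_mset (proots p). count (proots p) a)"
    using assms(2) by (intro sum.mono_neutral_right) (auto simp: not_in_iff)
  also have "\<dots> \<le> size (proots p)"
    unfolding size_multiset_overloaded_eq by (intro sum_mono2) auto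
  also have "\<dots> \<le> degree p" by (rule size_proots_le)
  finally show ?thesis using assms(1) by simp
qed

text \<open>The points $z$ and $t$ collide at $t = z$. The substitution $\zeta \mapsto z + (t - z)\zeta$
  separates them to $0$ and $1$, and it makes every factor of the Wronskian at either point contribute a
  factor $t - z$, with one more from the chain rule.\<close>

lemma dvd_cross_det_moving_point:
  fixes F G H :: "complex poly poly" and C :: "complex poly"
  assumes W: "wronskian F G = [:C:] * [:-[:z:], 1:] ^ m * [:-[:0, 1:], 1:] ^ n * H"
  shows "C * [:-z, 1:] ^ (m + n + 1) dvd cross_det F G [:z:] [:0, 1:]"
proof -
  define u where "u = [:-z, 1:]"
  define q where "q = [:[:z:], u:]"
  have pq: "pcompose (p ^ k) q = pcompose p q ^ k" for p :: "complex poly poly" and k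
    by (induction k) (simp_all add: pcompose_mult pcompose_1)
  have u_pow: "[:C * u ^ (m + n + 1):] = [:C:] * [:u:] ^ m * [:u:] ^ n * [:u:]"
    by (simp add: poly_const_pow power_add mult_ac)
  have "wronskian (pcompose F q) (pcompose G q) = pcompose (wronskian F G) q * [:u:]"
    by (simp add: wronskian_def pderiv_pcompose pcompose_diff pcompose_mult q_def pderiv_pCons algebra_simps)
  also have "pcompose (wronskian F G) q = [:C:] * ([:u:] * [:0, 1:]) ^ m * ([:u:] * [:-1, 1:]) ^ n * pcompose H q"
  proof -
    have "pcompose [:-[:z:], 1:] q = [:u:] * [:0, 1:]" "pcompose [:-[:0, 1:], 1:] q = [:u:] * [:-1, 1:]"
      by (simp_all add: q_def u_def pcompose_pCons)
    then show ?thesis unfolding W by (simp only: pcompose_mult pq pcompose_const)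
  qed
  finally have "wronskian (pcompose F q) (pcompose G q)
     = [:C * u ^ (m + n + 1):] * ([:0, 1:] ^ m * [:-1, 1:] ^ n * pcompose H q)"
    unfolding u_pow by (simp only: power_mult_distrib mult_ac)
  then have "C * u ^ (m + n + 1) dvd cross_det (pcompose F q) (pcompose G q) 0 1"
    by (intro dvd_wronskian_imp_dvd_cross_det) (metis dvd_triv_left)
  then show ?thesis by (simp add: cross_det_def poly_pcompose q_def u_def)
qed

text \<open>A family of rational maps $F/G$ of degree $d$ over the $t$-line cannot fix the four points
  $z_1, z_2, z_3, t$ and be ramified at them with total ramification $\ge d$ and at no other finite point. By the
  fixed point equations the determinants are $(p - q)\,G(p)\,G(q)$, so the lemmas above bound the divisor
  of the product of the four values $G(p)$: it is divisible by
  $C^2 \prod_i (t - z_i)^{m_i + n}$, and its degree is at most $2 \deg C + 2n + d - 1$, where $C$ is the factor of the Wronskian that depends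
  on $t$ alone.\<close>

theorem fixed_ramification_bound:
  fixes F G :: "complex poly poly" and C :: "complex poly"
  assumes deg: "degree F \<le> d" "degree G \<le> d"
    and dist: "z1 \<noteq> z2" "z1 \<noteq> z3" "z2 \<noteq> z3"
    and C: "C \<noteq> 0"
    and W: "wronskian F G = [:C:] * [:-[:z1:], 1:] ^ m1 * [:-[:z2:], 1:] ^ m2 * [:-[:z3:], 1:] ^ m3
              * [:-[:0, 1:], 1:] ^ n"
    and fixed: "\<And>p. p \<in> {[:z1:], [:z2:], [:z3:], [:0, 1:]} \<Longrightarrow> poly F p = p * poly G p"
    and nz: "\<And>p. p \<in> {[:z1:], [:z2:], [:z3:], [:0, 1:]} \<Longrightarrow> poly G p \<noteq> 0"
  shows "m1 + m2 + m3 + n < d"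
proof -
  define \<mu> where "\<mu> = poly G"
  define X :: "complex poly" where "X = [:0, 1:]"
  have cd: "cross_det F G p q = (p - q) * (\<mu> p * \<mu> q)"
    if "p \<in> {[:z1:], [:z2:], [:z3:], X}" "q \<in> {[:z1:], [:z2:], [:z3:], X}" for p q
    using fixed[of p] fixed[of q] that 
    by (simp add: cross_det_def \<mu>_def algebra_simps X_def)
  have \<mu>: "\<mu> [:z1:] \<noteq> 0" "\<mu> [:z2:] \<noteq> 0" "\<mu> [:z3:] \<noteq> 0" "\<mu> X \<noteq> 0"
    using nz by (simp_all add: \<mu>_def X_def)
  have const: "C dvd \<mu> [:a:] * \<mu> [:b:]" if "a \<in> {z1, z2, z3}" "b \<in> {z1, z2, z3}" "a \<noteq> b" for a b
  proof -
    have "C dvd cross_det F G [:a:] [:b:]"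
      by (rule dvd_wronskian_imp_dvd_cross_det) (simp only: W mult.assoc dvd_triv_left)
    also have "\<dots> = smult (a - b) (\<mu> [:a:] * \<mu> [:b:])" using that by (subst cd) auto
    finally show ?thesis using that(3) by (simp add: dvd_smult_iff)
  qed
  have moving: "C * [:-a, 1:] ^ (m + n) dvd \<mu> [:a:] * \<mu> X"
    if am: "(a, m) \<in> {(z1, m1), (z2, m2), (z3, m3)}" for a m
  proof -
    obtain H where "wronskian F G = [:C:] * [:-[:a:], 1:] ^ m * [:-[:0, 1:], 1:] ^ n * H"
    proof -
      from am consider "a = z1" "m = m1" | "a = z2" "m = m2" | "a = z3" "m = m3" by auto
      then show ?thesis
      proof cases
        case 1
        show ?thesis by (rule that[of "[:-[:z2:], 1:] ^ m2 * [:-[:z3:], 1:] ^ m3"]) (simp only: W 1 mult_ac)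
      next
        case 2
        show ?thesis by (rule that[of "[:-[:z1:], 1:] ^ m1 * [:-[:z3:], 1:] ^ m3"]) (simp only: W 2 mult_ac)
      next
        case 3
        show ?thesis by (rule that[of "[:-[:z1:], 1:] ^ m1 * [:-[:z2:], 1:] ^ m2"]) (simp only: W 3 mult_ac)
      qed
    qed
    then have "C * [:-a, 1:] ^ (m + n + 1) dvd cross_det F G [:a:] X"
      unfolding X_def by (rule dvd_cross_det_moving_point)
    also have "\<dots> = - ([:-a, 1:] * (\<mu> [:a:] * \<mu> X))" using am by (subst cd) (auto simp: X_def)
    finally have "[:-a, 1:] * (C * [:-a, 1:] ^ (m + n)) dvd [:-a, 1:] * (\<mu> [:a:] * \<mu> X)"
      by (simp only: dvd_minus_iff power_add power_one_right mult_ac)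
    then show ?thesis by (subst (asm) dvd_mult_cancel_left) simp
  qed
  \<comment> \<open>The product of the four values splits in three ways into a pair with $t$ and a pair without it;
    each splitting exhibits the extra factor at one collision.\<close>
  obtain S where S: "\<mu> [:z1:] * \<mu> [:z2:] * (\<mu> [:z3:] * \<mu> X) = C * C * S"
  proof -
    have "C * C dvd \<mu> [:z1:] * \<mu> [:z2:] * (\<mu> [:z3:] * \<mu> X)"
      using const[of z1 z2] dvd_mult_left[OF moving[of z3 m3]] dist by (intro mult_dvd_mono) auto
    then show ?thesis using that by (auto elim: dvdE)
  qed
  have split: "[:-a, 1:] ^ (m + n) dvd S"
    if "(a, m) \<in> {(z1, m1), (z2, m2), (z3, m3)}" "b \<in> {z1, z2, z3}" "c \<in> {z1, z2, z3}" "b \<noteq> c"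
      and eq: "\<mu> [:z1:] * \<mu> [:z2:] * (\<mu> [:z3:] * \<mu> X) = \<mu> [:a:] * \<mu> X * (\<mu> [:b:] * \<mu> [:c:])" for a b c m
  proof -
    have "(C * [:-a, 1:] ^ (m + n)) * C dvd C * C * S"
      unfolding S[symmetric] eq using that by (intro mult_dvd_mono moving const)
    then have "(C * C) * [:-a, 1:] ^ (m + n) dvd (C * C) * S" by (simp only: mult_ac)
    then show ?thesis using C by (subst (asm) dvd_mult_cancel_left) simp
  qed
  have "[:-z1, 1:] ^ (m1 + n) dvd S"
    by (rule split[of z1 m1 z2 z3]) (use dist in \<open>auto simp: mult_ac\<close>)
  moreover have "[:-z2, 1:] ^ (m2 + n) dvd S"
    by (rule split[of z2 m2 z1 z3]) (use dist in \<open>auto simp: mult_ac\<close>)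
  moreover have "[:-z3, 1:] ^ (m3 + n) dvd S"
    by (rule split[of z3 m3 z1 z2]) (use dist in \<open>auto simp: mult_ac\<close>)
  ultimately have "m1 + n \<le> order z1 S" "m2 + n \<le> order z2 S" "m3 + n \<le> order z3 S" and S0: "S \<noteq> 0"
    using S \<mu> by (auto simp: order_divides)
  moreover have "order z1 S + order z2 S + order z3 S \<le> degree S"
    using sum_order_le_degree[OF S0, of "{z1, z2, z3}"] dist by simp
  ultimately have lower: "m1 + m2 + m3 + 3 * n \<le> degree S" by linarith
  have Wnz: "wronskian F G \<noteq> 0" using C by (simp add: W)
  have Wdeg: "degree (coeff (wronskian F G) i) \<le> degree C + n" for i
  proof -
    have lin: "degree (coeff [:-[:a:], 1:] i) \<le> 0" for a :: complex and i
      by (auto simp: coeff_pCons split: nat.split)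
    have linX: "degree (coeff [:-[:0, 1::complex:], 1:] i) \<le> 1" for i
      by (auto simp: coeff_pCons split: nat.split)
    have C': "degree (coeff [:C:] i) \<le> degree C" for i
      by (auto simp: coeff_pCons split: nat.split)
    have "degree (coeff (wronskian F G) i) \<le> degree C + m1 * 0 + m2 * 0 + m3 * 0 + n * 1"
      unfolding W by (intro degree_coeff_mult_le degree_coeff_power_le lin linX C')
    then show ?thesis by simp
  qed
  obtain N1 N2 where N: "\<And>i. degree (coeff F i) \<le> N1" "\<And>i. degree (coeff G i) \<le> N2"
  proof -
    have "\<exists>N. \<forall>i. degree (coeff P i) \<le> N" for P :: "complex poly poly"
    proof -
      have "degree (coeff P i) \<le> (\<Sum>j\<le>degree P. degree (coeff P j))" for i
        by (cases "i \<le> degree P") (auto intro: member_le_sum simp: coeff_eq_0)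
      then show ?thesis by blast
    qed
    then show ?thesis using that by blast
  qed
  have "degree (cross_det F G [:z1:] [:z2:]) \<le> (degree C + n) + 0 * d"
    by (rule degree_cross_det_le[OF Wnz Wdeg N deg]) auto
  moreover have "cross_det F G [:z1:] [:z2:] = smult (z1 - z2) (\<mu> [:z1:] * \<mu> [:z2:])" by (subst cd) auto
  ultimately have d12: "degree (\<mu> [:z1:] * \<mu> [:z2:]) \<le> degree C + n" using dist by simp
  have "degree (cross_det F G [:z3:] X) \<le> (degree C + n) + 1 * d"
    by (rule degree_cross_det_le[OF Wnz Wdeg N deg]) (auto simp: X_def)
  moreover have "cross_det F G [:z3:] X = [:z3, -1:] * (\<mu> [:z3:] * \<mu> X)" by (subst cd) (auto simp: X_def)
  moreover have "degree ([:z3, -1:] * (\<mu> [:z3:] * \<mu> X)) = 1 + degree (\<mu> [:z3:] * \<mu> X)"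
    using \<mu> by (subst degree_mult_eq) auto
  ultimately have d3: "1 + degree (\<mu> [:z3:] * \<mu> X) \<le> degree C + n + d" by simp
  have "degree C + degree C + degree S = degree (\<mu> [:z1:] * \<mu> [:z2:]) + degree (\<mu> [:z3:] * \<mu> X)"
    using S C S0 \<mu> by (metis degree_mult_eq mult_eq_0_iff)
  then show ?thesis using lower d12 d3 by linarith
qed

section \<open>Transcendental parameters\<close>

text \<open>There are only countably many algebraic numbers: each is a root of one of countably many integer
  polynomials.\<close>

lemma ex_transcendental: "\<exists>x :: complex. \<not> algebraic x"
proof -
  define R where "R = (\<lambda>l :: int list. {x :: complex. poly (Poly (map of_int l)) x = 0 \<and> Poly (map of_int l) \<noteq> (0 :: complex poly)})"
  have "finite (R l)" for l
    by (cases "Poly (map of_int l) = (0 :: complex poly)") (auto simp: R_def poly_roots_finite)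
  then have "countable (\<Union>l. R l)" by (auto intro: countable_finite)
  moreover have "{x. algebraic x} \<subseteq> (\<Union>l. R l)"
  proof
    fix x :: complex assume "x \<in> {x. algebraic x}"
    then obtain p where p: "\<And>i. coeff p i \<in> \<int>" "p \<noteq> 0" "poly p x = 0"
      unfolding mem_Collect_eq algebraic_def by blast
    have "map of_int (map (\<lambda>c. \<lfloor>Re c\<rfloor>) (coeffs p)) = coeffs p"
    proof -
      have "of_int \<lfloor>Re c\<rfloor> = c" if "c \<in> set (coeffs p)" for c
      proof -
        from that obtain i where "c = coeff p i" by (auto simp: coeffs_def split: if_splits)
        then have "c \<in> \<int>" using p(1) by simp
        then show ?thesis by (auto elim: Ints_cases)
      qed
      then show ?thesis by (simp add: map_idI)
    qed
    then have "x \<in> R (map (\<lambda>c. \<lfloor>Re c\<rfloor>) (coeffs p))" using p by (simp add: R_def)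
    then show "x \<in> (\<Union>l. R l)" by blast
  qed
  ultimately have "countable {x :: complex. algebraic x}" using countable_subset by blast
  moreover have "uncountable (UNIV :: complex set)"
  proof
    assume "countable (UNIV :: complex set)"
    then have "countable (range Re)" by blast
    moreover have "range Re = UNIV" by (metis Re_complex_of_real surjI)
    ultimately show False using uncountable_UNIV_real by simp
  qed
  ultimately show ?thesis by (metis UNIV_eq_I mem_Collect_eq)
qed

text \<open>A unital subring given by its carrier; closure under subtraction yields sums and negatives.\<close>

definition is_subring :: "'a::comm_ring_1 set \<Rightarrow> bool" where
  "is_subring S \<longleftrightarrow> 0 \<in> S \<and> 1 \<in> S \<and> (\<forall>a\<in>S. \<forall>b\<in>S. a - b \<in> S \<and> a * b \<in> S)"

lemma is_subringD:
  assumes "is_subring S"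
  shows "0 \<in> S" "1 \<in> S" and "\<And>a b. a \<in> S \<Longrightarrow> b \<in> S \<Longrightarrow> a - b \<in> S"
    "\<And>a b. a \<in> S \<Longrightarrow> b \<in> S \<Longrightarrow> a * b \<in> S" "\<And>a. a \<in> S \<Longrightarrow> - a \<in> S"
    "\<And>a b. a \<in> S \<Longrightarrow> b \<in> S \<Longrightarrow> a + b \<in> S"
    "\<And>u A. (\<And>i. i \<in> A \<Longrightarrow> u i \<in> S) \<Longrightarrow> sum u A \<in> S"
    "\<And>a n. a \<in> S \<Longrightarrow> a ^ n \<in> S" "\<And>n. of_nat n \<in> S"
proof -
  show r: "0 \<in> S" "1 \<in> S" and d: "\<And>a b. a \<in> S \<Longrightarrow> b \<in> S \<Longrightarrow> a - b \<in> S"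
    and m: "\<And>a b. a \<in> S \<Longrightarrow> b \<in> S \<Longrightarrow> a * b \<in> S"
    using assms by (auto simp: is_subring_def)
  show u: "- a \<in> S" if "a \<in> S" for a using d[OF r(1) that] by simp
  show p: "a + b \<in> S" if "a \<in> S" "b \<in> S" for a b using d[OF that(1) u[OF that(2)]] by simp
  show "sum u A \<in> S" if "\<And>i. i \<in> A \<Longrightarrow> u i \<in> S" for u A
    using that by (induction A rule: infinite_finite_induct) (auto intro: p r)
  show "a ^ n \<in> S" if "a \<in> S" for a n using that by (induction n) (auto intro: m r)
  show "of_nat n \<in> S" for n by (induction n) (auto intro: p r)
qed

text \<open>Univariate polynomials with all coefficients in the set $S$.\<close>

definition polys_over :: "'a::zero set \<Rightarrow> 'a poly set" where
  "polys_over S = {p. \<forall>i. coeff p i \<in> S}"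

lemma is_subring_polys_over:
  assumes "is_subring S"
  shows "is_subring (polys_over S)"
  using is_subringD[OF assms]
  by (auto simp: is_subring_def polys_over_def coeff_mult intro!: is_subringD(7)[OF assms])

lemma polys_over_pCons:
  assumes "a \<in> S" "p \<in> polys_over S"
  shows "pCons a p \<in> polys_over S"
  using assms by (auto simp: polys_over_def coeff_pCons split: nat.split)

lemma pderiv_in_polys_over:
  assumes "is_subring S" "p \<in> polys_over S"
  shows "pderiv p \<in> polys_over S"
  using assms is_subringD[OF assms(1)] by (auto simp: polys_over_def coeff_pderiv simp del: of_nat_Suc)

lemma poly_in_subring:
  assumes "is_subring S" "p \<in> polys_over S" "x \<in> S"
  shows "poly p x \<in> S"
  unfolding poly_altdef using assms(2,3) by (intro is_subringD[OF assms(1)]) (auto simp: polys_over_def)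

lemma wronskian_in_polys_over:
  assumes "is_subring S" "p \<in> polys_over S" "q \<in> polys_over S"
  shows "wronskian p q \<in> polys_over S"
  unfolding wronskian_def
  by (intro is_subringD(3,4)[OF is_subring_polys_over] pderiv_in_polys_over assms)

lemma smult_in_polys_over:
  assumes "is_subring S" "a \<in> S" "p \<in> polys_over S"
  shows "smult a p \<in> polys_over S"
  using assms by (auto simp: polys_over_def intro: is_subringD)

text \<open>The field $\mathbb{Q}(x)$ generated by one complex number, as quotients of values of integer
  polynomials.\<close>

definition simple_ext :: "complex \<Rightarrow> complex set" where
  "simple_ext x = {poly p x / poly q x | p q. p \<in> polys_over \<int> \<and> q \<in> polys_over \<int> \<and> poly q x \<noteq> 0}"

lemma is_subring_Ints: "is_subring (\<int> :: 'a::comm_ring_1 set)"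
  by (simp add: is_subring_def)

lemmas int_polys_ring = is_subringD[OF is_subring_polys_over[OF is_subring_Ints]]

lemma is_subfield_simple_ext: "is_subfield (simple_ext x)"
proof -
  have I: "a \<in> simple_ext x" if "a = poly p x / poly q x" "p \<in> polys_over \<int>" "q \<in> polys_over \<int>" "poly q x \<noteq> 0" for a p q
    using that unfolding simple_ext_def by blast
  have "0 \<in> simple_ext x" by (rule I[of _ 0 1]) (auto intro: int_polys_ring)
  moreover have "1 \<in> simple_ext x" by (rule I[of _ 1 1]) (auto intro: int_polys_ring)
  moreover have "a - b \<in> simple_ext x \<and> a * b \<in> simple_ext x" if "a \<in> simple_ext x" "b \<in> simple_ext x" for a b
  proof -
    obtain p q where a: "a = poly p x / poly q x" "p \<in> polys_over \<int>" "q \<in> polys_over \<int>" "poly q x \<noteq> 0"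
      using \<open>a \<in> _\<close> unfolding simple_ext_def by blast
    obtain p' q' where b: "b = poly p' x / poly q' x" "p' \<in> polys_over \<int>" "q' \<in> polys_over \<int>" "poly q' x \<noteq> 0"
      using \<open>b \<in> _\<close> unfolding simple_ext_def by blast
    have "a - b \<in> simple_ext x"
      by (rule I[of _ "p * q' - p' * q" "q * q'"]) (use a b in \<open>auto intro: int_polys_ring simp: diff_frac_eq algebra_simps\<close>)
    moreover have "a * b \<in> simple_ext x"
      by (rule I[of _ "p * p'" "q * q'"]) (use a b in \<open>auto intro: int_polys_ring\<close>)
    ultimately show ?thesis ..
  qed
  moreover have "inverse a \<in> simple_ext x" if "a \<in> simple_ext x" for a
  proof -
    obtain p q where a: "a = poly p x / poly q x" "p \<in> polys_over \<int>" "q \<in> polys_over \<int>" "poly q x \<noteq> 0"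
      using \<open>a \<in> _\<close> unfolding simple_ext_def by blast
    show ?thesis
    proof (cases "poly p x = 0")
      case True
      then show ?thesis using a \<open>0 \<in> simple_ext x\<close> by simp
    next
      case False
      then show ?thesis by (intro I[of _ q p]) (use a in auto)
    qed
  qed
  ultimately show ?thesis by (simp add: is_subfield_def)
qed

lemma Ints_subset_simple_ext: 
  assumes "a \<in> \<int>" shows "a \<in> simple_ext x"
proof -
  have "[:a:] \<in> polys_over \<int>" using assms by (intro polys_over_pCons) (auto intro: int_polys_ring)
  moreover have "(1 :: complex poly) \<in> polys_over \<int>" by (rule int_polys_ring)
  moreover have "a = poly [:a:] x / poly 1 x" "poly 1 x \<noteq> 0" by simp_all
  ultimately show ?thesis unfolding simple_ext_def by blast
qed

lemma generator_in_simple_ext: "x \<in> simple_ext x"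
proof -
  have "([:0, 1:] :: complex poly) \<in> polys_over \<int>" by (intro polys_over_pCons) (auto intro: int_polys_ring)
  moreover have "(1 :: complex poly) \<in> polys_over \<int>" by (rule int_polys_ring)
  moreover have "x = poly [:0, 1:] x / poly 1 x" "poly 1 x \<noteq> 0" by simp_all
  ultimately show ?thesis unfolding simple_ext_def by blast
qed

lemma clear_denominators:
  assumes "f \<in> polys_over (simple_ext x)"
  shows "\<exists>r F. r \<in> polys_over \<int> \<and> poly r x \<noteq> 0 \<and> F \<in> polys_over (polys_over \<int>) \<and>
      map_poly (\<lambda>p. poly p x) F = smult (poly r x) f"
  using assms
proof (induction f)
  case 0
  then show ?case
    by (intro exI[of _ 1] exI[of _ 0]) (auto intro: int_polys_ring is_subringD is_subring_polys_over is_subring_Ints)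
next
  case (pCons a f)
  have "coeff (pCons a f) (Suc i) \<in> simple_ext x" for i 
    using pCons.prems by (auto simp: polys_over_def simp del: coeff_pCons_Suc)
  then have "f \<in> polys_over (simple_ext x)" by (simp add: polys_over_def)
  then obtain r F where rF: "r \<in> polys_over \<int>" "poly r x \<noteq> 0" "F \<in> polys_over (polys_over \<int>)"
    "map_poly (\<lambda>p. poly p x) F = smult (poly r x) f" using pCons.IH by blast
  have "coeff (pCons a f) 0 \<in> simple_ext x"
    using pCons.prems by (auto simp: polys_over_def simp del: coeff_pCons_0)
  then obtain p q where pq: "a = poly p x / poly q x" "p \<in> polys_over \<int>" "q \<in> polys_over \<int>" "poly q x \<noteq> 0"
    by (auto simp: simple_ext_def)
  have "map_poly (\<lambda>p. poly p x) (pCons (r * p) (smult q F)) = smult (poly (r * q) x) (pCons a f)"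
  proof (rule poly_eqI)
    fix i
    show "coeff (map_poly (\<lambda>p. poly p x) (pCons (r * p) (smult q F))) i = coeff (smult (poly (r * q) x) (pCons a f)) i"
    proof (cases i)
      case 0
      then show ?thesis using pq by (simp add: coeff_map_poly)
    next
      case (Suc j)
      have "poly (coeff F j) x = poly r x * coeff f j"
        using arg_cong[OF rF(4), of "\<lambda>p. coeff p j"] by (simp add: coeff_map_poly)
      then show ?thesis using Suc by (simp add: coeff_map_poly)
    qed
  qed
  moreover have "pCons (r * p) (smult q F) \<in> polys_over (polys_over \<int>)"
    using rF pq
    by (intro polys_over_pCons smult_in_polys_over is_subring_polys_over is_subring_Ints int_polys_ring)
  moreover have "r * q \<in> polys_over \<int>" "poly (r * q) x \<noteq> 0" using rF pq by (auto intro: int_polys_ring)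
  ultimately show ?case by blast
qed

text \<open>For transcendental $x$ the field $\mathbb{Q}(x)$ is a rational function field, so one map over
  it with fixed ramification at $z_1, z_2, z_3, x$ spreads out to a family over the $t$-line: clear
  denominators and replace $x$ by $t$. Identities among polynomials with integer coefficients survive
  this replacement because evaluation at $x$ is injective on $\mathbb{Z}[t]$.\<close>

theorem fixed_ramification_bound_transcendental:
  fixes f g :: "complex poly"
  assumes trans: "\<not> algebraic x"
    and f: "f \<in> polys_over (simple_ext x)" "degree f \<le> d" 
    and g: "g \<in> polys_over (simple_ext x)" "degree g \<le> d"
    and z: "z1 \<in> \<int>" "z2 \<in> \<int>" "z3 \<in> \<int>" and dist: "z1 \<noteq> z2" "z1 \<noteq> z3" "z2 \<noteq> z3"
    and c: "c \<noteq> 0"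
    and W: "wronskian f g = smult c ([:-z1, 1:] ^ m1 * [:-z2, 1:] ^ m2 * [:-z3, 1:] ^ m3 * [:-x, 1:] ^ n)"
    and fixed: "\<And>a. a \<in> {z1, z2, z3, x} \<Longrightarrow> poly f a = a * poly g a"
    and nz: "\<And>a. a \<in> {z1, z2, z3, x} \<Longrightarrow> poly g a \<noteq> 0"
  shows "m1 + m2 + m3 + n < d"
proof -
  define ev where "ev = (\<lambda>p. poly p x)"
  define X :: "complex poly" where "X = [:0, 1:]"
  have ev0: "ev 0 = 0" by (simp add: ev_def)
  have ev_hom: "ev 1 = 1" "ev (p + q) = ev p + ev q" "ev (p * q) = ev p * ev q" for p q
    by (simp_all add: ev_def)
  note R = is_subringD[OF is_subring_polys_over[OF is_subring_Ints]] 
    is_subringD[OF is_subring_polys_over[OF is_subring_polys_over[OF is_subring_Ints]]]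
  have inj: "p = 0" if "p \<in> polys_over \<int>" "ev p = 0" for p
    using trans that by (auto simp: polys_over_def ev_def algebraic_def)
  have inj2: "P = 0" if "P \<in> polys_over (polys_over \<int>)" "map_poly ev P = 0" for P
  proof (rule poly_eqI)
    fix i
    have "ev (coeff P i) = 0" using arg_cong[OF that(2), of "\<lambda>p. coeff p i"] by (simp add: coeff_map_poly ev0)
    then show "coeff P i = coeff 0 i" using inj[of "coeff P i"] that(1) by (simp add: polys_over_def)
  qed
  obtain r F0 where F0: "r \<in> polys_over \<int>" "ev r \<noteq> 0" "F0 \<in> polys_over (polys_over \<int>)"
    "map_poly ev F0 = smult (ev r) f"
    using clear_denominators[OF f(1)] unfolding ev_def by blast
  obtain s G0 where G0: "s \<in> polys_over \<int>" "ev s \<noteq> 0" "G0 \<in> polys_over (polys_over \<int>)"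
    "map_poly ev G0 = smult (ev s) g"
    using clear_denominators[OF g(1)] unfolding ev_def by blast
  define F where "F = smult s F0"
  define G where "G = smult r G0"
  \<comment> \<open>a common denominator, so that $F$ and $G$ lift $f$ and $g$ with the same factor\<close>
  define t where "t = ev r * ev s"
  have t: "t \<noteq> 0" using F0 G0 by (simp add: t_def)
  have F: "F \<in> polys_over (polys_over \<int>)" "map_poly ev F = smult t f"
  proof -
    show "F \<in> polys_over (polys_over \<int>)"
      unfolding F_def by (intro smult_in_polys_over is_subring_polys_over is_subring_Ints F0 G0)
    have "map_poly ev F = smult (ev s) (map_poly ev F0)"
      by (rule poly_eqI) (simp add: F_def coeff_map_poly ev0 ev_hom)
    then show "map_poly ev F = smult t f" by (simp add: F0 t_def mult.commute)
  qed
  have G: "G \<in> polys_over (polys_over \<int>)" "map_poly ev G = smult t g"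
  proof -
    show "G \<in> polys_over (polys_over \<int>)"
      unfolding G_def by (intro smult_in_polys_over is_subring_polys_over is_subring_Ints F0 G0)
    have "map_poly ev G = smult (ev r) (map_poly ev G0)"
      by (rule poly_eqI) (simp add: G_def coeff_map_poly ev0 ev_hom)
    then show "map_poly ev G = smult t g" by (simp add: G0 t_def)
  qed
  have deg_le: "degree P \<le> d"
    if "P \<in> polys_over (polys_over \<int>)" "map_poly ev P = smult t p" "degree p \<le> d" for P p
  proof (rule degree_le, intro allI impI)
    fix i assume "d < i"
    then have "ev (coeff P i) = 0"
      using arg_cong[OF that(2), of "\<lambda>p. coeff p i"] that(3) by (simp add: coeff_map_poly ev0 coeff_eq_0)
    then show "coeff P i = 0" using inj that(1) by (simp add: polys_over_def[of "polys_over \<int>"])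
  qed
  have evpoly: "ev (poly P p) = poly (map_poly ev P) (ev p)" for P p
    by (induction P) (simp_all add: map_poly_pCons ev_hom ev0)
  have points: "p \<in> polys_over \<int>" "ev p \<in> {z1, z2, z3, x}" if "p \<in> {[:z1:], [:z2:], [:z3:], X}" for p
    using that z R by (auto simp: X_def ev_def intro!: polys_over_pCons)
  have fixedF: "poly F p = p * poly G p" if p: "p \<in> {[:z1:], [:z2:], [:z3:], X}" for p
  proof -
    have "ev (poly F p - p * poly G p) = t * (poly f (ev p) - ev p * poly g (ev p))"
      using evpoly[of F p] evpoly[of G p] F(2) G(2) by (simp add: ev_def algebra_simps)
    also have "\<dots> = 0" using fixed points(2)[OF p] by simp
    finally have "poly F p - p * poly G p = 0"
      using F(1) G(1) points(1)[OF p] R is_subring_polys_over[OF is_subring_Ints]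
      by (intro inj) (auto intro!: R poly_in_subring)
    then show ?thesis by simp
  qed
  have nzG: "poly G p \<noteq> 0" if p: "p \<in> {[:z1:], [:z2:], [:z3:], X}" for p
  proof
    assume "poly G p = 0"
    then have "t * poly g (ev p) = 0" using evpoly[of G p] G(2) by (simp add: ev0)
    then show False using nz points(2)[OF p] t by auto
  qed
  define P where "P = [:-[:z1:], 1:] ^ m1 * [:-[:z2:], 1:] ^ m2 * [:-[:z3:], 1:] ^ m3 * [:-X, 1:] ^ n"
  have P: "P \<in> polys_over (polys_over \<int>)"
  proof -
    have lin: "[:-p, 1:] \<in> polys_over (polys_over \<int>)" if "p \<in> {[:z1:], [:z2:], [:z3:], X}" for p
      using points(1)[OF that] by (intro polys_over_pCons R) auto
    show ?thesis unfolding P_def by (intro R lin) simp_all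
  qed
  have mapP: "map_poly ev P = [:-z1, 1:] ^ m1 * [:-z2, 1:] ^ m2 * [:-z3, 1:] ^ m3 * [:-x, 1:] ^ n" (is "_ = ?p")
  proof -
    have mult: "map_poly ev (p * q) = map_poly ev p * map_poly ev q" for p q
      by (rule map_poly_hom_mult) (simp_all add: ev0 ev_hom)
    have pow: "map_poly ev (p ^ k) = map_poly ev p ^ k" for p k
      by (induction k) (simp_all add: mult map_poly_1 ev_hom)
    have lin: "map_poly ev [:-p, 1:] = [:- ev p, 1:]" for p
      by (simp add: map_poly_pCons ev0 ev_hom) (simp add: ev_def)
    show ?thesis unfolding P_def mult pow lin by (simp add: ev_def X_def)
  qed
  have "lead_coeff ?p = 1" by (simp add: lead_coeff_mult lead_coeff_power)
  define V where "V = wronskian F G"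
  define C where "C = coeff V (degree ?p)"
  have "map_poly ev V = wronskian (smult t f) (smult t g)"
    unfolding V_def F(2)[symmetric] G(2)[symmetric]
    by (rule wronskian_map_poly[symmetric]) (simp_all add: ev0 ev_hom)
  also have "\<dots> = smult (t * t * c) ?p"
    using W by (simp add: wronskian_def pderiv_smult smult_diff_right[symmetric])
  finally have mapV: "map_poly ev V = smult (t * t * c) ?p" .
  have evC: "ev C = t * t * c"
    using arg_cong[OF mapV, of "\<lambda>q. coeff q (degree ?p)"] \<open>lead_coeff ?p = 1\<close>
    by (simp add: coeff_map_poly ev0 C_def)
  have V: "V \<in> polys_over (polys_over \<int>)"
    unfolding V_def by (intro wronskian_in_polys_over is_subring_polys_over is_subring_Ints F G)
  then have C: "C \<in> polys_over \<int>" by (simp add: C_def polys_over_def[of "polys_over \<int>"])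
  have "V - smult C P \<in> polys_over (polys_over \<int>)"
    by (intro R V smult_in_polys_over C P is_subring_polys_over is_subring_Ints)
  moreover have "map_poly ev (V - smult C P) = map_poly ev V - smult (ev C) (map_poly ev P)"
    by (rule poly_eqI) (simp add: coeff_map_poly ev0, simp add: ev_def)
  then have "map_poly ev (V - smult C P) = 0" by (simp add: mapV mapP evC)
  ultimately have "V = smult C P" using inj2 by fastforce
  then have W': "wronskian F G = [:C:] * [:-[:z1:], 1:] ^ m1 * [:-[:z2:], 1:] ^ m2 * [:-[:z3:], 1:] ^ m3 
      * [:-[:0, 1:], 1:] ^ n"
    unfolding V_def P_def X_def by (simp add: mult.assoc)
  have "C \<noteq> 0" using evC t c ev0 by auto
  then show ?thesis
    using fixed_ramification_bound[OF deg_le[OF F f(2)] deg_le[OF G g(2)] dist _ W'] fixedF nzG unfolding X_def by blast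
qed

section \<open>Polynomials in two variables\<close>

abbreviation "lookup \<equiv> Poly_Mapping.lookup"
abbreviation "keys \<equiv> Poly_Mapping.keys"
abbreviation "single \<equiv> Poly_Mapping.single"

lemma sum_single_keys: "(\<Sum>t\<in>keys p. single t (lookup p t)) = p"
proof (rule poly_mapping_eqI)
  fix k
  have "lookup (\<Sum>t\<in>keys p. single t (lookup p t)) k = (\<Sum>t\<in>keys p. if t = k then lookup p t else 0)"
    by (simp add: lookup_sum lookup_single when_def)
  then show "lookup (\<Sum>t\<in>keys p. single t (lookup p t)) k = lookup p k" by (simp add: in_keys_iff)
qed

lemma poly_mapping_terms_induct [case_names zero single add]:
  fixes p :: "'a \<Rightarrow>\<^sub>0 'b::comm_monoid_add"
  assumes zero: "P 0" and single: "\<And>t. t \<in> keys p \<Longrightarrow> P (single t (lookup p t))"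
    and add: "\<And>p q. P p \<Longrightarrow> P q \<Longrightarrow> P (p + q)"
  shows "P p"
proof -
  have "P (\<Sum>t\<in>A. single t (lookup p t))" if "finite A" "A \<subseteq> keys p" for A
    using that by (induction A rule: finite_induct) (auto intro: zero single add)
  then have "P (\<Sum>t\<in>keys p. single t (lookup p t))" by simp
  then show ?thesis by (simp add: sum_single_keys)
qed

lemma polys_induct [consumes 1, case_names zero single add]:
  assumes "p \<in> polys K l" and "P 0" 
    and "\<And>t c. keys t \<subseteq> {..<l} \<Longrightarrow> c \<in> K \<Longrightarrow> P (single t c)"
    and "\<And>p q. P p \<Longrightarrow> P q \<Longrightarrow> P (p + q)"
  shows "P p"
proof (rule poly_mapping_terms_induct[of P p])
  show "P (single t (lookup p t))" if "t \<in> keys p" for t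
    using assms(1,3) that by (auto simp: polys_def)
qed (use assms in auto)

text \<open>A subfield is a subring closed under division; the case $b = 0$ of the last claim relies on
  $a / 0 = 0$.\<close>

lemma is_subfieldD:
  assumes "is_subfield K"
  shows "is_subring K" "\<And>a. a \<in> K \<Longrightarrow> inverse a \<in> K" "\<And>a b. a \<in> K \<Longrightarrow> b \<in> K \<Longrightarrow> a / b \<in> K"
proof -
  show r: "is_subring K" and i: "\<And>a. a \<in> K \<Longrightarrow> inverse a \<in> K"
    using assms by (auto simp: is_subfield_def is_subring_def)
  show "a / b \<in> K" if "a \<in> K" "b \<in> K" for a b
    unfolding divide_inverse using that is_subringD(4)[OF r] i by blast
qed

lemma single_in_polys: "c \<in> K \<Longrightarrow> keys t \<subseteq> {..<l} \<Longrightarrow> single t c \<in> polys K l"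
  by (simp add: polys_def)

lemma is_subring_polys:
  assumes "is_subring K"
  shows "is_subring (polys K l)"
proof -
  note K = is_subringD[OF assms]
  have lookup: "p \<in> polys K l \<longleftrightarrow> (\<forall>t. lookup p t \<in> K) \<and> (\<forall>t\<in>keys p. keys t \<subseteq> {..<l})" for p
    using K(1) by (auto simp: polys_def in_keys_iff)
  have zero: "0 \<in> polys K l" by (simp add: polys_def)
  have diff: "p - q \<in> polys K l" if "p \<in> polys K l" "q \<in> polys K l" for p q
    using that K(3) keys_diff[of p q] unfolding lookup by (auto simp: lookup_minus) blast
  have add: "p + q \<in> polys K l" if "p \<in> polys K l" "q \<in> polys K l" for p q
    using diff[OF that(1) diff[OF zero that(2)]] by simp
  have "p * q \<in> polys K l" if p: "p \<in> polys K l" and q: "q \<in> polys K l" for p q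
    using p
  proof (induction p rule: polys_induct)
    case (single t c)
    note tc = this
    show ?case using q
    proof (induction q rule: polys_induct)
      case (single t' c')
      then show ?case using tc keys_add[of t t'] unfolding mult_single 
        by (intro single_in_polys K) auto
    qed (auto simp: zero distrib_left intro: add)
  qed (auto simp: zero distrib_right intro: add)
  moreover have "1 \<in> polys K l" using single_in_polys[of 1 K 0 l] K by simp
  ultimately show ?thesis using zero diff by (simp add: is_subring_def)
qed

lemma pconst_in_polys: "c \<in> K \<Longrightarrow> pconst c \<in> polys K l"
  by (simp add: pconst_def single_in_polys)

lemma pvar_in_polys: "is_subring K \<Longrightarrow> i < l \<Longrightarrow> pvar i \<in> polys K l"
  by (simp add: pvar_def single_in_polys is_subringD)

lemma pconst_add: "pconst (a + b) = pconst a + pconst b"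
  and pconst_mult: "pconst (a * b) = pconst a * pconst b"
  and pconst_0: "pconst 0 = 0" and pconst_1: "pconst 1 = 1"
  by (simp_all add: pconst_def single_add mult_single)

text \<open>The ring homomorphism to univariate polynomials that sends the first two variables to $X$ and
  $Y$. All further variables are sent to $1$; they do not occur where it is used.\<close>

definition eval2 :: "'k::field_char_0 poly \<Rightarrow> 'k poly \<Rightarrow> 'k mpoly \<Rightarrow> 'k poly" where
  "eval2 X Y p = (\<Sum>t\<in>keys p. smult (lookup p t) (X ^ lookup t 0 * Y ^ lookup t 1))"

lemma eval2_0: "eval2 X Y 0 = 0"
  by (simp add: eval2_def)

lemma eval2_single: "eval2 X Y (single t c) = smult c (X ^ lookup t 0 * Y ^ lookup t 1)"
  by (simp add: eval2_def)

lemma eval2_add: "eval2 X Y (p + q) = eval2 X Y p + eval2 X Y q"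
  unfolding eval2_def
  by (rule setsum_keys_plus_distrib) (simp_all add: smult_add_left)

lemma eval2_diff: "eval2 X Y (p - q) = eval2 X Y p - eval2 X Y q"
  using eval2_add[of X Y "p - q" q] by simp

lemma eval2_mult: "eval2 X Y (p * q) = eval2 X Y p * eval2 X Y q"
proof (induction p rule: poly_mapping_terms_induct)
  case (single t)
  show ?case
  proof (induction q rule: poly_mapping_terms_induct)
    case (single t')
    show ?case by (simp add: mult_single eval2_single lookup_add power_add mult_ac)
  qed (simp_all add: eval2_0 eval2_add distrib_left)
qed (simp_all add: eval2_0 eval2_add distrib_right)

lemma eval2_pconst: "eval2 X Y (pconst c) = [:c:]"
  by (simp add: pconst_def eval2_single)

lemma eval2_pvar: "eval2 X Y (pvar 0) = X" "eval2 X Y (pvar (Suc 0)) = Y"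
  by (simp_all add: pvar_def eval2_single lookup_single)

lemma eval2_1: "eval2 X Y 1 = 1"
  using eval2_pconst[of X Y 1] by (simp add: pconst_1)

lemma eval2_power: "eval2 X Y (p ^ n) = eval2 X Y p ^ n"
  by (induction n) (simp_all add: eval2_1 eval2_mult)

lemma eval2_sum: "eval2 X Y (sum u A) = (\<Sum>a\<in>A. eval2 X Y (u a))"
  by (induction A rule: infinite_finite_induct) (simp_all add: eval2_0 eval2_add)

lemma eval2_prod: "eval2 X Y (prod u A) = (\<Prod>a\<in>A. eval2 X Y (u a))"
  by (induction A rule: infinite_finite_induct) (simp_all add: eval2_1 eval2_mult)

lemmas eval2_simps = eval2_0 eval2_1 eval2_add eval2_diff eval2_mult eval2_pconst eval2_pvar 
  eval2_power eval2_sum eval2_prod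

lemma eval2_in_polys_over:
  assumes "is_subring K" "X \<in> polys_over K" "Y \<in> polys_over K" "p \<in> polys K l"
  shows "eval2 X Y p \<in> polys_over K"
proof -
  note R = is_subringD[OF is_subring_polys_over[OF assms(1)]]
  show ?thesis
    unfolding eval2_def using assms(4)
    by (intro R smult_in_polys_over assms(1-3)) (auto simp: polys_def)
qed

text \<open>Dehomogenisation: the affine coordinate is $x_0$ on the line $x_1 = 1$.\<close>

abbreviation dehom :: "'k::field_char_0 mpoly \<Rightarrow> 'k poly" where
  "dehom \<equiv> eval2 [:0, 1:] 1"

lemma eval2_partial_deriv:
  "eval2 X Y (partial_deriv i p) = (\<Sum>t\<in>keys p. smult (of_nat (lookup t i) * lookup p t)
      (X ^ (lookup t 0 - (if i = 0 then 1 else 0)) * Y ^ (lookup t 1 - (if i = 1 then 1 else 0))))"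
proof -
  have "lookup (t - single i 1) j = lookup t j - (if i = j then 1 else 0)" for t :: "nat \<Rightarrow>\<^sub>0 nat" and j
    by (simp add: lookup_minus lookup_single when_def)
  then show ?thesis by (simp add: partial_deriv_def eval2_sum eval2_single)
qed

lemma dehom_eq: "dehom p = (\<Sum>t\<in>keys p. monom (lookup p t) (lookup t 0))"
  by (simp add: eval2_def monom_altdef)

lemma pderiv_sum_monom: "pderiv (\<Sum>t\<in>A. monom (c t) (e t)) = (\<Sum>t\<in>A. monom (of_nat (e t) * c t) (e t - 1))"
  by (induction A rule: infinite_finite_induct) (simp_all add: pderiv_add pderiv_monom)

lemma dehom_partial_deriv_0: "dehom (partial_deriv 0 p) = pderiv (dehom p)"
  unfolding eval2_partial_deriv dehom_eq pderiv_sum_monom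
  by (rule sum.cong) (simp_all add: monom_altdef)

lemma sum_keys_two:
  assumes "keys t \<subseteq> {..<2::nat}"
  shows "(\<Sum>i\<in>keys t. lookup t i) = lookup t 0 + lookup t (1::nat)"
proof -
  have "(\<Sum>i\<in>keys t. lookup t i) = (\<Sum>i\<in>{..<2}. lookup t i)"
    using assms by (intro sum.mono_neutral_left) (auto simp: in_keys_iff)
  then show ?thesis by (simp add: numeral_2_eq_2 lessThan_Suc add.commute)
qed

lemma homogeneous_exponents:
  assumes "p \<in> polys K 2" "homogeneous_poly d p" "t \<in> keys p"
  shows "lookup t 0 + lookup t 1 = d"
  using assms sum_keys_two[of t] by (simp add: polys_def homogeneous_poly_def)

lemma degree_dehom_le:
  assumes "p \<in> polys K 2" "homogeneous_poly d p"
  shows "degree (dehom p) \<le> d"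
  unfolding dehom_eq
proof (rule degree_sum_le)
  fix t assume "t \<in> keys p"
  then have "lookup t 0 \<le> d" using homogeneous_exponents[OF assms] by fastforce
  then show "degree (monom (lookup p t) (lookup t 0)) \<le> d"
    by (rule order_trans[OF degree_monom_le])
qed simp

text \<open>Euler's identity for homogeneous polynomials, in the affine coordinate.\<close>

lemma dehom_partial_deriv_1:
  assumes "p \<in> polys K 2" "homogeneous_poly d p"
  shows "dehom (partial_deriv 1 p) = smult (of_nat d) (dehom p) - [:0, 1:] * pderiv (dehom p)"
proof -
  have "smult (of_nat (lookup t 1) * lookup p t) ([:0, 1:] ^ lookup t 0)
      = smult (of_nat d) (monom (lookup p t) (lookup t 0)) 
        - [:0, 1:] * monom (of_nat (lookup t 0) * lookup p t) (lookup t 0 - 1)" if "t \<in> keys p" for t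
  proof -
    have d: "of_nat d = of_nat (lookup t 0) + (of_nat (lookup t 1) :: 'a)"
      using homogeneous_exponents[OF assms that] by (metis of_nat_add)
    have "[:0, 1:] * monom (of_nat (lookup t 0) * lookup p t) (lookup t 0 - 1) 
       = monom (of_nat (lookup t 0) * lookup p t) (lookup t 0)"
      by (cases "lookup t 0") (simp_all add: monom_Suc)
    then show ?thesis by (simp add: d smult_monom add_monom diff_monom monom_altdef[symmetric] algebra_simps)
  qed
  moreover have "smult a (sum u A) = (\<Sum>t\<in>A. smult a (u t))" for a :: 'a and u and A :: "(nat \<Rightarrow>\<^sub>0 nat) set"
    by (induction A rule: infinite_finite_induct) (simp_all add: smult_add_right)
  ultimately show ?thesis
    unfolding eval2_partial_deriv dehom_eq pderiv_sum_monom
    by (simp add: sum_subtractf sum_distrib_left)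
qed

text \<open>Restricted to the line $x_1 = 0$, a form of degree $d - 1$ is a multiple of the $(d-1)$-st power
  of the coordinate.\<close>

lemma dvd_eval2_partial_deriv:
  assumes "p \<in> polys K 2" "homogeneous_poly d p"
  shows "[:0, 1:] ^ (d - 1) dvd eval2 [:0, 1:] 0 (partial_deriv i p)"
  unfolding eval2_partial_deriv
proof (rule dvd_sum)
  fix t assume t: "t \<in> keys p"
  define a where "a = lookup t 0 - (if i = 0 then 1 else 0)"
  define b where "b = lookup t 1 - (if i = 1 then 1 else 0)"
  have "b \<noteq> 0 \<or> d - 1 \<le> a" using homogeneous_exponents[OF assms t] by (auto simp: a_def b_def)
  then have "[:0, 1:] ^ (d - 1) dvd [:0, 1:] ^ a * (0 :: 'a poly) ^ b"
    by (auto simp: le_imp_power_dvd power_0_left)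
  then show "[:0, 1:] ^ (d - 1) dvd smult (of_nat (lookup t i) * lookup p t)
      ([:0, 1:] ^ (lookup t 0 - (if i = 0 then 1 else 0)) * 0 ^ (lookup t 1 - (if i = 1 then 1 else 0)))"
    unfolding a_def b_def by (rule dvd_smult)
qed

section \<open>Freeness of plane multiarrangements\<close>

text \<open>The line with parameter $z$ is the kernel of $x_0 - z x_1$; every line through the origin other
  than $x_1 = 0$ has this form.\<close>

definition line_form :: "'k::field_char_0 \<Rightarrow> 'k mpoly" where
  "line_form z = pvar 0 - pconst z * pvar 1"

text \<open>The value of a derivation on $x_0 - z x_1$.\<close>

definition line_der :: "'k::field_char_0 \<Rightarrow> 'k deriv \<Rightarrow> 'k mpoly" where
  "line_der z \<theta> = \<theta> 0 - pconst z * \<theta> 1"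

text \<open>The module of derivations tangent with multiplicities $n$ to the lines with parameters in $Z$, written
  with the explicit forms $x_0 - z x_1$.\<close>

definition plane_multi_der :: "'k::field_char_0 set \<Rightarrow> 'k set \<Rightarrow> ('k \<Rightarrow> nat) \<Rightarrow> 'k deriv set" where
  "plane_multi_der K Z n = {\<theta> \<in> Der K 2. \<forall>z\<in>Z. \<exists>q\<in>polys K 2. line_der z \<theta> = q * line_form z ^ n z}"

text \<open>The coefficient determinant of two plane derivations.\<close>

definition der_det :: "'k::field_char_0 deriv \<Rightarrow> 'k deriv \<Rightarrow> 'k mpoly" where
  "der_det \<theta> \<eta> = \<theta> 0 * \<eta> 1 - \<theta> 1 * \<eta> 0"

text \<open>Restriction of a polynomial to the line $x_0 = z x_1$, with coordinate $x_1$.\<close>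

abbreviation restrict_line :: "'k::field_char_0 \<Rightarrow> 'k mpoly \<Rightarrow> 'k poly" where
  "restrict_line z \<equiv> eval2 [:0, z:] [:0, 1:]"

lemma restrict_line_form: "restrict_line z (line_form z) = 0"
  by (simp add: line_form_def eval2_simps)

lemma line_form_nonzero: "line_form z \<noteq> 0"
proof
  assume "line_form z = 0"
  then have "eval2 1 0 (line_form z) = 0" by (simp add: eval2_0)
  then show False by (simp add: line_form_def eval2_simps)
qed

lemma line_form_in_polys: "is_subring K \<Longrightarrow> z \<in> K \<Longrightarrow> line_form z \<in> polys K 2"
  unfolding line_form_def
  by (intro is_subringD[OF is_subring_polys] pvar_in_polys pconst_in_polys) auto

lemma Der2_eqI: "\<theta> \<in> Der K 2 \<Longrightarrow> \<eta> \<in> Der K 2 \<Longrightarrow> \<theta> 0 = \<eta> 0 \<Longrightarrow> \<theta> 1 = \<eta> 1 \<Longrightarrow> \<theta> = \<eta>"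
proof (rule ext)
  fix i :: nat assume a: "\<theta> \<in> Der K 2" "\<eta> \<in> Der K 2" "\<theta> 0 = \<eta> 0" "\<theta> 1 = \<eta> 1"
  consider "i = 0" | "i = 1" | "2 \<le> i" by linarith
  then show "\<theta> i = \<eta> i" by cases (use a in \<open>auto simp: Der_def\<close>)
qed

lemma pconst_power: "pconst (c ^ k) = pconst c ^ k"
  by (induction k) (simp_all add: pconst_1 pconst_mult)

text \<open>Modulo $x_0 - z x_1$ a polynomial is congruent to its restriction, read as a polynomial in
  $x_1$.\<close>

lemma polys_mod_line_form:
  assumes K: "is_subring K" and z: "z \<in> K" and p: "p \<in> polys K 2"
  shows "\<exists>q\<in>polys K 2. p = poly (map_poly pconst (restrict_line z p)) (pvar 1) + line_form z * q"
  using p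
proof (induction p rule: polys_induct)
  case zero
  show ?case using is_subringD(1)[OF is_subring_polys[OF K]] by (intro bexI[of _ 0]) (auto simp: eval2_0)
next
  case (single t c)
  note S = is_subringD[OF is_subring_polys[OF K, of 2]]
  define x :: "'a mpoly" where "x = pvar 0"
  define y :: "'a mpoly" where "y = pvar 1"
  have xy: "x \<in> polys K 2" "y \<in> polys K 2" "pconst z * y \<in> polys K 2"
    using K z by (auto simp: x_def y_def intro!: S pvar_in_polys pconst_in_polys)
  have pow: "single (single i k) 1 = (pvar i :: 'a mpoly) ^ k" for i k
  proof (induction k)
    case (Suc k)
    have "single (single i (Suc k)) 1 = single (single i 1) 1 * (single (single i k) 1 :: 'a mpoly)"
      by (simp add: mult_single single_add[symmetric])
    then show ?case by (simp only: Suc pvar_def power_Suc)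
  qed simp
  have t: "t = single 0 (lookup t 0) + single 1 (lookup t 1)"
  proof (rule poly_mapping_eqI)
    fix i
    show "lookup t i = lookup (single 0 (lookup t 0) + single 1 (lookup t 1)) i"
    proof (cases "i < 2")
      case True
      then show ?thesis by (auto simp: lookup_add lookup_single less_2_cases_iff)
    next
      case False
      then have "lookup t i = 0" using single(1) by (auto simp: in_keys_iff)
      then show ?thesis using False by (simp add: lookup_add lookup_single when_def)
    qed
  qed
  have "single t c = pconst c * (single (single 0 (lookup t 0)) 1 * single (single 1 (lookup t 1)) 1)"
    by (subst t) (simp add: pconst_def mult_single)
  then have p: "single t c = pconst c * (x ^ lookup t 0 * y ^ lookup t 1)"
    unfolding pow x_def y_def .
  define a where "a = lookup t 0"
  define b where "b = lookup t 1"
  define r where "r = (\<Sum>i<a. (pconst z * y) ^ (a - Suc i) * x ^ i)"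
  have r: "r \<in> polys K 2" unfolding r_def by (intro S xy)
  have diff: "x ^ a - (pconst z * y) ^ a = line_form z * r"
    by (simp add: r_def line_form_def x_def[symmetric] y_def[symmetric] power_diff_sumr2 del: One_nat_def)
  have "[:0, z:] ^ a = smult (z ^ a) ([:0, 1:] ^ a)" 
    using smult_power[of z "[:0, 1:]" a] by simp
  then have "restrict_line z (single t c) = monom (c * z ^ a) (a + b)"
    by (simp add: eval2_single a_def b_def monom_altdef power_add)
  then have "poly (map_poly pconst (restrict_line z (single t c))) y 
      = pconst c * ((pconst z * y) ^ a * y ^ b)"
    by (simp add: map_poly_monom pconst_0 poly_monom pconst_mult pconst_power power_add power_mult_distrib mult_ac)
  moreover have "single t c = pconst c * ((pconst z * y) ^ a * y ^ b) + line_form z * (r * (pconst c * y ^ b))"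
  proof -
    have "line_form z * (r * (pconst c * y ^ b)) = (x ^ a - (pconst z * y) ^ a) * (pconst c * y ^ b)"
      unfolding diff by (simp only: mult_ac)
    then show ?thesis unfolding p a_def[symmetric] b_def[symmetric] by (simp add: algebra_simps)
  qed
  moreover have "r * (pconst c * y ^ b) \<in> polys K 2"
    using single(2) by (intro S r xy pconst_in_polys)
  ultimately show ?case unfolding y_def by metis
next
  case (add p q)
  have "map_poly pconst (u + v) = map_poly pconst u + map_poly pconst v" for u v :: "'a poly"
    by (rule poly_eqI) (simp add: coeff_map_poly pconst_0 pconst_add)
  then have split: "poly (map_poly pconst (restrict_line z (p + q))) y
     = poly (map_poly pconst (restrict_line z p)) y + poly (map_poly pconst (restrict_line z q)) y" for y
    by (simp add: eval2_add)
  obtain q1 q2 where q1: "q1 \<in> polys K 2" "q2 \<in> polys K 2"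
    and p: "p = poly (map_poly pconst (restrict_line z p)) (pvar 1) + line_form z * q1" (is "p = ?p + _")
    and q: "q = poly (map_poly pconst (restrict_line z q)) (pvar 1) + line_form z * q2" (is "q = ?q + _")
    using add by blast
  have "?p + line_form z * q1 + (?q + line_form z * q2) = ?p + ?q + line_form z * (q1 + q2)"
    by (simp only: distrib_left add_ac)
  then have "p + q = ?p + ?q + line_form z * (q1 + q2)" unfolding p[symmetric] q[symmetric] .
  then show ?case unfolding split using is_subringD(6)[OF is_subring_polys[OF K] q1] by blast
qed

lemma line_form_dvd_iff:
  assumes "is_subring K" "z \<in> K" "p \<in> polys K 2"
  shows "(\<exists>q\<in>polys K 2. p = line_form z * q) \<longleftrightarrow> restrict_line z p = 0"
proof
  show "restrict_line z p = 0" if "\<exists>q\<in>polys K 2. p = line_form z * q"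
    using that by (auto simp: eval2_mult restrict_line_form)
  show "\<exists>q\<in>polys K 2. p = line_form z * q" if "restrict_line z p = 0"
    using polys_mod_line_form[OF assms] that by simp
qed

text \<open>Two generators with nonzero determinant; the determinant condition replaces linear independence
  and is easy to follow through changes of basis.\<close>

definition det_basis :: "'k::field_char_0 set \<Rightarrow> 'k deriv set \<Rightarrow> 'k deriv \<Rightarrow> 'k deriv \<Rightarrow> bool" where
  "det_basis K M \<theta> \<eta> \<longleftrightarrow> \<theta> \<in> M \<and> \<eta> \<in> M \<and> der_det \<theta> \<eta> \<noteq> 0 \<and>
     (\<forall>\<zeta>\<in>M. \<exists>a\<in>polys K 2. \<exists>b\<in>polys K 2. \<zeta> = (\<lambda>i. a * \<theta> i + b * \<eta> i))"

lemma det_basis_swap: "det_basis K M \<theta> \<eta> \<Longrightarrow> det_basis K M \<eta> \<theta>"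
proof -
  assume basis: "det_basis K M \<theta> \<eta>"
  have "der_det \<eta> \<theta> = - der_det \<theta> \<eta>" by (simp add: der_det_def algebra_simps)
  moreover have "\<exists>a\<in>polys K 2. \<exists>b\<in>polys K 2. \<zeta> = (\<lambda>i. a * \<eta> i + b * \<theta> i)" if \<zeta>: "\<zeta> \<in> M" for \<zeta>
  proof -
    obtain a b where ab: "a \<in> polys K 2" "b \<in> polys K 2" "\<zeta> = (\<lambda>i. a * \<theta> i + b * \<eta> i)"
      using basis \<zeta> unfolding det_basis_def by blast
    have "\<zeta> = (\<lambda>i. b * \<eta> i + a * \<theta> i)" unfolding ab(3) by (simp only: add.commute)
    then show ?thesis using ab(1,2) by blast
  qed
  ultimately show ?thesis using basis unfolding det_basis_def by simp
qed

lemma det_basis_imp_free_module: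
  assumes "is_subring K" "det_basis K M \<theta> \<eta>"
  shows "free_module (polys K 2) M"
proof -
  have det: "der_det \<theta> \<eta> \<noteq> 0" and M: "\<theta> \<in> M" "\<eta> \<in> M"
    and span: "\<And>\<zeta>. \<zeta> \<in> M \<Longrightarrow> \<exists>a\<in>polys K 2. \<exists>b\<in>polys K 2. \<zeta> = (\<lambda>i. a * \<theta> i + b * \<eta> i)"
    using assms(2) by (auto simp: det_basis_def)
  have neq: "\<theta> \<noteq> \<eta>" using det by (auto simp: der_det_def)
  have "module_basis (polys K 2) M {\<theta>, \<eta>}"
    unfolding module_basis_def
  proof (intro conjI ballI allI impI)
    show "{\<theta>, \<eta>} \<subseteq> M" using M by simp
  next
    fix \<zeta> assume "\<zeta> \<in> M"
    then obtain a b where ab: "a \<in> polys K 2" "b \<in> polys K 2" "\<zeta> = (\<lambda>i. a * \<theta> i + b * \<eta> i)"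
      using span by blast
    then show "\<exists>F c. finite F \<and> F \<subseteq> {\<theta>, \<eta>} \<and> (\<forall>b\<in>F. c b \<in> polys K 2) \<and> \<zeta> = (\<lambda>i. \<Sum>b\<in>F. c b * b i)"
      using neq by (intro exI[of _ "{\<theta>, \<eta>}"] exI[of _ "\<lambda>u. if u = \<theta> then a else b"]) auto
  next
    fix F c b
    assume F: "finite F \<and> F \<subseteq> {\<theta>, \<eta>} \<and> (\<forall>b\<in>F. c b \<in> polys K 2) \<and> (\<lambda>i. \<Sum>b\<in>F. c b * b i) = (\<lambda>_. 0)"
      and "b \<in> F"
    define u where "u = (\<lambda>\<zeta>. if \<zeta> \<in> F then c \<zeta> else 0)"
    have comb: "u \<theta> * \<theta> i + u \<eta> * \<eta> i = 0" for i
    proof -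
      have "(\<Sum>\<zeta>\<in>F. c \<zeta> * \<zeta> i) = (\<Sum>\<zeta>\<in>{\<theta>, \<eta>}. u \<zeta> * \<zeta> i)"
        using F by (intro sum.mono_neutral_cong_left) (auto simp: u_def)
      moreover have "(\<Sum>\<zeta>\<in>F. c \<zeta> * \<zeta> i) = 0" using F by meson
      ultimately show ?thesis using neq by simp
    qed
    have "u \<theta> * der_det \<theta> \<eta> = (u \<theta> * \<theta> 0 + u \<eta> * \<eta> 0) * \<eta> 1 - (u \<theta> * \<theta> 1 + u \<eta> * \<eta> 1) * \<eta> 0"
      by (simp add: der_det_def algebra_simps)
    moreover have "u \<eta> * der_det \<theta> \<eta> = (u \<theta> * \<theta> 1 + u \<eta> * \<eta> 1) * \<theta> 0 - (u \<theta> * \<theta> 0 + u \<eta> * \<eta> 0) * \<theta> 1"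
      by (simp add: der_det_def algebra_simps)
    ultimately have "u \<theta> = 0" "u \<eta> = 0" unfolding comb using det by auto
    then show "c b = 0" using F \<open>b \<in> F\<close> by (auto simp: u_def split: if_splits)
  qed
  then show ?thesis by (auto simp: free_module_def)
qed

lemma line_der_comb: "line_der z (\<lambda>i. a * \<theta> i + b * \<eta> i) = a * line_der z \<theta> + b * line_der z \<eta>"
  by (simp add: line_der_def algebra_simps)

lemma plane_multi_der_comb:
  assumes K: "is_subring K" and "\<theta> \<in> plane_multi_der K Z n" "\<eta> \<in> plane_multi_der K Z n"
    and ab: "a \<in> polys K 2" "b \<in> polys K 2"
  shows "(\<lambda>i. a * \<theta> i + b * \<eta> i) \<in> plane_multi_der K Z n"
proof -
  note S = is_subringD[OF is_subring_polys[OF K]]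
  have "\<exists>q\<in>polys K 2. line_der z (\<lambda>i. a * \<theta> i + b * \<eta> i) = q * line_form z ^ n z" if z: "z \<in> Z" for z
  proof -
    obtain q1 q2 where "q1 \<in> polys K 2" "q2 \<in> polys K 2"
      "line_der z \<theta> = q1 * line_form z ^ n z" "line_der z \<eta> = q2 * line_form z ^ n z"
      using assms(2,3) z unfolding plane_multi_der_def by blast
    then show ?thesis using ab unfolding line_der_comb
      by (intro bexI[of _ "a * q1 + b * q2"]) (auto simp: algebra_simps intro: S)
  qed
  moreover have "(\<lambda>i. a * \<theta> i + b * \<eta> i) \<in> Der K 2"
    using assms(2,3) ab S by (auto simp: plane_multi_der_def Der_def)
  ultimately show ?thesis by (simp add: plane_multi_der_def)
qed

text \<open>The degree shifted by one, so that zero is strictly smaller than nonzero constants.\<close>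

definition poly_size :: "'a::zero poly \<Rightarrow> nat" where
  "poly_size p = (if p = 0 then 0 else Suc (degree p))"

lemma euclid_step:
  fixes \<theta> \<eta> :: "'k::field_char_0 deriv"
  assumes K: "is_subfield K" and z: "z \<in> K" 
    and basis: "det_basis K (plane_multi_der K Z n) \<theta> \<eta>"
    and q: "q1 \<in> polys K 2" "q2 \<in> polys K 2" "line_der z \<theta> = q1 * P" "line_der z \<eta> = q2 * P"
    and nz: "restrict_line z q1 \<noteq> 0" "restrict_line z q2 \<noteq> 0"
    and le: "degree (restrict_line z q1) \<le> degree (restrict_line z q2)"
  obtains \<eta>' q2' where "det_basis K (plane_multi_der K Z n) \<theta> \<eta>'" "q2' \<in> polys K 2"
    "line_der z \<eta>' = q2' * P" "poly_size (restrict_line z q2') < poly_size (restrict_line z q2)"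
proof -
  note Kr = is_subfieldD(1)[OF K]
  note S = is_subringD[OF is_subring_polys[OF Kr, of 2]]
  define u where "u = restrict_line z q1"
  define v where "v = restrict_line z q2"
  define c where "c = lead_coeff v / lead_coeff u"
  define w where "w = pconst c * pvar 1 ^ (degree v - degree u)"
  have "u \<in> polys_over K" "v \<in> polys_over K" unfolding u_def v_def
    by (intro eval2_in_polys_over[OF Kr _ _ q(1)] eval2_in_polys_over[OF Kr _ _ q(2)]
         polys_over_pCons is_subringD[OF Kr] is_subringD[OF is_subring_polys_over[OF Kr]] z)+
  then have "c \<in> K" unfolding c_def by (intro is_subfieldD[OF K]) (auto simp: polys_over_def)
  then have w: "w \<in> polys K 2" unfolding w_def
    by (intro S pconst_in_polys pvar_in_polys Kr) simp_all
  define \<eta>' where "\<eta>' = (\<lambda>i. - w * \<theta> i + 1 * \<eta> i)"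
  define q2' where "q2' = q2 - w * q1"
  have "det_basis K (plane_multi_der K Z n) \<theta> \<eta>'"
    unfolding det_basis_def
  proof (intro conjI ballI)
    show "\<theta> \<in> plane_multi_der K Z n" using basis by (simp add: det_basis_def)
    show "\<eta>' \<in> plane_multi_der K Z n"
      unfolding \<eta>'_def using basis by (intro plane_multi_der_comb Kr S w) (auto simp: det_basis_def)
    have "der_det \<theta> \<eta>' = der_det \<theta> \<eta>" by (simp add: der_det_def \<eta>'_def algebra_simps)
    then show "der_det \<theta> \<eta>' \<noteq> 0" using basis by (simp add: det_basis_def)
    fix \<zeta> assume "\<zeta> \<in> plane_multi_der K Z n"
    then obtain a b where ab: "a \<in> polys K 2" "b \<in> polys K 2" "\<zeta> = (\<lambda>i. a * \<theta> i + b * \<eta> i)"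
      using basis unfolding det_basis_def by blast
    then show "\<exists>a\<in>polys K 2. \<exists>b\<in>polys K 2. \<zeta> = (\<lambda>i. a * \<theta> i + b * \<eta>' i)"
      by (intro bexI[of _ "a + b * w"] bexI[of _ b]) (auto simp: \<eta>'_def algebra_simps intro: S w)
  qed
  moreover have "q2' \<in> polys K 2" unfolding q2'_def by (intro S q w)
  moreover have "line_der z \<eta>' = q2' * P"
    unfolding \<eta>'_def line_der_comb q by (simp add: q2'_def algebra_simps)
  moreover have "poly_size (restrict_line z q2') < poly_size (restrict_line z q2)"
  proof -
    have eq: "restrict_line z q2' = v - monom c (degree v - degree u) * u"
      by (simp add: q2'_def w_def u_def v_def eval2_simps monom_altdef)
    have nz': "u \<noteq> 0" "v \<noteq> 0" using nz by (simp_all add: u_def v_def)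
    have "c \<noteq> 0" using nz' by (simp add: c_def)
    then have deg: "degree (monom c (degree v - degree u) * u) = degree v"
      using le nz' by (subst degree_mult_eq) (auto simp: degree_monom_eq u_def v_def)
    have "coeff (monom c (degree v - degree u) * u) (degree v) = lead_coeff v"
      using le nz' coeff_monom_mult[of c "degree v - degree u" u "degree v"] by (simp add: c_def u_def v_def)
    then have lc: "coeff (restrict_line z q2') (degree v) = 0" unfolding eq by simp
    have "degree (restrict_line z q2') \<le> degree v" unfolding eq using deg by (intro degree_diff_le) auto
    then have "restrict_line z q2' = 0 \<or> degree (restrict_line z q2') < degree v"
      using lc by (metis le_neq_implies_less leading_coeff_0_iff)
    then show ?thesis using nz' by (auto simp: poly_size_def v_def)
  qed
  ultimately show ?thesis by (rule that)
qed

text \<open>The Euclidean algorithm on the restrictions of the two quotients to the line, lifted to the plane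
  as elementary operations on the basis. It ends with a quotient that vanishes on the line.\<close>

lemma euclid_basis:
  fixes \<theta> \<eta> :: "'k::field_char_0 deriv"
  assumes K: "is_subfield K" and z: "z \<in> K" 
    and "det_basis K (plane_multi_der K Z n) \<theta> \<eta>"
    and "q1 \<in> polys K 2" "q2 \<in> polys K 2" "line_der z \<theta> = q1 * P" "line_der z \<eta> = q2 * P"
  shows "\<exists>\<theta> \<eta> q1 q2. det_basis K (plane_multi_der K Z n) \<theta> \<eta> \<and> q1 \<in> polys K 2 \<and> q2 \<in> polys K 2 \<and>
    line_der z \<theta> = q1 * P \<and> line_der z \<eta> = q2 * P \<and> restrict_line z q2 = 0"
  using assms(3-)
proof (induction "poly_size (restrict_line z q1) + poly_size (restrict_line z q2)"
    arbitrary: \<theta> \<eta> q1 q2 rule: less_induct)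
  case less
  consider "restrict_line z q2 = 0" | "restrict_line z q1 = 0"
    | "restrict_line z q1 \<noteq> 0" "restrict_line z q2 \<noteq> 0" "degree (restrict_line z q1) \<le> degree (restrict_line z q2)"
    | "restrict_line z q1 \<noteq> 0" "restrict_line z q2 \<noteq> 0" "degree (restrict_line z q2) \<le> degree (restrict_line z q1)"
    by linarith
  then show ?case
  proof cases
    case 1
    then show ?thesis using less.prems by blast
  next
    case 2
    then show ?thesis using less.prems det_basis_swap by blast
  next
    case 3
    obtain \<eta>' q2' where "det_basis K (plane_multi_der K Z n) \<theta> \<eta>'" "q2' \<in> polys K 2"
      "line_der z \<eta>' = q2' * P" "poly_size (restrict_line z q2') < poly_size (restrict_line z q2)"
      by (rule euclid_step[OF K z less.prems 3])
    then show ?thesis using less.prems by (intro less.hyps[of q1 q2' \<theta> \<eta>']) auto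
  next
    case 4
    obtain \<theta>' q1' where *: "det_basis K (plane_multi_der K Z n) \<eta> \<theta>'" "q1' \<in> polys K 2"
      "line_der z \<theta>' = q1' * P" "poly_size (restrict_line z q1') < poly_size (restrict_line z q1)"
      by (rule euclid_step[OF K z det_basis_swap[OF less.prems(1)] less.prems(3,2,5,4) 4(2,1,3)])
    then show ?thesis using less.prems by (intro less.hyps[of q2 q1' \<eta> \<theta>']) auto
  qed
qed

text \<open>Raising one multiplicity by one: take a basis $\theta, \eta$ in which $\eta$ is already tangent to the
  higher order along the line $\alpha = x_0 - z x_1 = 0$. If $\theta$ is not, then $\alpha\theta, \eta$ is a basis of the smaller module, since
  a combination $a\theta + b\eta$ lies in it only if $a$ vanishes on the line.\<close>

theorem plane_multi_der_basis:
  fixes K :: "'k::field_char_0 set"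
  assumes K: "is_subfield K" and Z: "finite Z" "Z \<subseteq> K"
  shows "\<exists>\<theta> \<eta>. det_basis K (plane_multi_der K Z n) \<theta> \<eta>"
proof (induction "\<Sum>z\<in>Z. n z" arbitrary: n)
  case 0
  note Kr = is_subfieldD(1)[OF K]
  note S = is_subringD[OF is_subring_polys[OF Kr, of 2]]
  have n: "n z = 0" if "z \<in> Z" for z using 0 Z that by simp
  have line_der: "line_der z \<theta> \<in> polys K 2" if "z \<in> Z" "\<theta> \<in> Der K 2" for z \<theta>
    unfolding line_der_def using that Z by (intro S pconst_in_polys) (auto simp: Der_def)
  have M: "plane_multi_der K Z n = Der K 2"
    using line_der n by (auto simp: plane_multi_der_def)
  define e where "e = (\<lambda>(j::nat) i. if i = j then 1 else 0 :: 'k mpoly)"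
  have "det_basis K (Der K 2) (e 0) (e 1)"
    unfolding det_basis_def
  proof (intro conjI ballI)
    show "e 0 \<in> Der K 2" "e 1 \<in> Der K 2" using S by (auto simp: e_def Der_def)
    show "der_det (e 0) (e 1) \<noteq> 0" by (simp add: der_det_def e_def)
    fix \<zeta> assume \<zeta>: "\<zeta> \<in> Der K 2"
    then have "\<zeta> = (\<lambda>i. \<zeta> 0 * e 0 i + \<zeta> 1 * e 1 i)"
      by (intro Der2_eqI[OF \<zeta>]) (auto simp: Der_def e_def)
    then show "\<exists>a\<in>polys K 2. \<exists>b\<in>polys K 2. \<zeta> = (\<lambda>i. a * e 0 i + b * e 1 i)"
      using \<zeta> by (intro bexI[of _ "\<zeta> 0"] bexI[of _ "\<zeta> 1"]) (auto simp: Der_def)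
  qed
  then show ?case unfolding M by blast
next
  case (Suc N)
  note Kr = is_subfieldD(1)[OF K]
  note S = is_subringD[OF is_subring_polys[OF Kr, of 2]]
  obtain z where z: "z \<in> Z" "n z \<noteq> 0" using Suc.hyps(2) by (metis sum.neutral Zero_not_Suc)
  \<comment> \<open>the induction hypothesis is applied after lowering one positive multiplicity\<close>
  define n' where "n' = n(z := n z - 1)"
  have "(\<Sum>w\<in>Z. n w) = n z + (\<Sum>w\<in>Z - {z}. n w)" "(\<Sum>w\<in>Z. n' w) = n' z + (\<Sum>w\<in>Z - {z}. n' w)"
    using Z z by (simp_all add: sum.remove)
  moreover have "(\<Sum>w\<in>Z - {z}. n' w) = (\<Sum>w\<in>Z - {z}. n w)" by (rule sum.cong) (auto simp: n'_def)
  ultimately have "N = (\<Sum>w\<in>Z. n' w)" using Suc.hyps(2) z by (simp add: n'_def)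
  then obtain \<theta>0 \<eta>0 where basis0: "det_basis K (plane_multi_der K Z n') \<theta>0 \<eta>0"
    using Suc.hyps(1) by blast
  have zK: "z \<in> K" using z Z by blast
  define L where "L = line_form z"
  have L: "L \<in> polys K 2" "L \<noteq> 0" using line_form_in_polys Kr zK line_form_nonzero by (auto simp: L_def)
  have nz: "n z = Suc (n' z)" using z by (simp add: n'_def)
  obtain q10 q20 where "q10 \<in> polys K 2" "q20 \<in> polys K 2" "line_der z \<theta>0 = q10 * L ^ n' z" "line_der z \<eta>0 = q20 * L ^ n' z"
    using basis0 z unfolding det_basis_def plane_multi_der_def L_def by blast
  from euclid_basis[OF K zK basis0 this] obtain \<theta> \<eta> q1 q2 where basis: "det_basis K (plane_multi_der K Z n') \<theta> \<eta>"
    and q: "q1 \<in> polys K 2" "q2 \<in> polys K 2" "line_der z \<theta> = q1 * L ^ n' z" "line_der z \<eta> = q2 * L ^ n' z"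
    "restrict_line z q2 = 0" by blast
  have mem: "\<zeta> \<in> plane_multi_der K Z n \<longleftrightarrow> \<zeta> \<in> plane_multi_der K Z n' \<and> (\<exists>q\<in>polys K 2. line_der z \<zeta> = q * L ^ n z)" for \<zeta>
  proof -
    have other: "n w = n' w" if "w \<noteq> z" for w using that by (simp add: n'_def)
    have down: "\<exists>q\<in>polys K 2. line_der z \<zeta> = q * L ^ n' z" if "\<exists>q\<in>polys K 2. line_der z \<zeta> = q * L ^ n z"
    proof -
      from that obtain q where "q \<in> polys K 2" "line_der z \<zeta> = q * L ^ n z" by blast
      then show ?thesis by (intro bexI[of _ "q * L"]) (simp_all add: nz mult_ac S L)
    qed
    show ?thesis
    proof
      assume \<zeta>: "\<zeta> \<in> plane_multi_der K Z n"
      then have zz: "\<exists>q\<in>polys K 2. line_der z \<zeta> = q * L ^ n z"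
        using z(1) by (simp add: plane_multi_der_def L_def)
      have "\<exists>q\<in>polys K 2. line_der w \<zeta> = q * line_form w ^ n' w" if "w \<in> Z" for w
      proof (cases "w = z")
        case True
        then show ?thesis using down[OF zz] by (simp add: L_def)
      next
        case False
        have "\<exists>q\<in>polys K 2. line_der w \<zeta> = q * line_form w ^ n w"
          using \<zeta> that by (simp add: plane_multi_der_def)
        then show ?thesis unfolding other[OF False] .
      qed
      then show "\<zeta> \<in> plane_multi_der K Z n' \<and> (\<exists>q\<in>polys K 2. line_der z \<zeta> = q * L ^ n z)"
        using \<zeta> zz by (simp add: plane_multi_der_def)
    next
      assume \<zeta>: "\<zeta> \<in> plane_multi_der K Z n' \<and> (\<exists>q\<in>polys K 2. line_der z \<zeta> = q * L ^ n z)"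
      have "\<exists>q\<in>polys K 2. line_der w \<zeta> = q * line_form w ^ n w" if "w \<in> Z" for w
      proof (cases "w = z")
        case True
        then show ?thesis using \<zeta> by (simp add: L_def)
      next
        case False
        have "\<exists>q\<in>polys K 2. line_der w \<zeta> = q * line_form w ^ n' w"
          using \<zeta> that by (simp add: plane_multi_der_def)
        then show ?thesis unfolding other[OF False] .
      qed
      then show "\<zeta> \<in> plane_multi_der K Z n" using \<zeta> by (simp add: plane_multi_der_def)
    qed
  qed
  have lift: "\<zeta> \<in> plane_multi_der K Z n" if lift: "\<zeta> \<in> plane_multi_der K Z n'" "line_der z \<zeta> = q * L ^ n' z"
    "q \<in> polys K 2" "restrict_line z q = 0" for \<zeta> q
  proof -
    obtain q' where "q' \<in> polys K 2" "q = L * q'"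
      using line_form_dvd_iff[OF Kr zK lift(3)] lift(4) unfolding L_def by blast
    then show ?thesis using lift unfolding mem nz by (auto simp: mult_ac)
  qed
  have \<eta>: "\<eta> \<in> plane_multi_der K Z n" using basis q by (intro lift[of \<eta> q2]) (auto simp: det_basis_def)
  show ?case
  proof (cases "restrict_line z q1 = 0")
    case True
    then have "\<theta> \<in> plane_multi_der K Z n" using basis q by (intro lift[of \<theta> q1]) (auto simp: det_basis_def)
    then have "det_basis K (plane_multi_der K Z n) \<theta> \<eta>"
      using basis \<eta> mem unfolding det_basis_def by blast
    then show ?thesis by blast
  next
    case False
    define \<theta>' where "\<theta>' = (\<lambda>i. L * \<theta> i + 0 * \<eta> i)"
    have "det_basis K (plane_multi_der K Z n) \<theta>' \<eta>"
      unfolding det_basis_def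
    proof (intro conjI ballI)
      show "\<theta>' \<in> plane_multi_der K Z n"
      proof (rule lift[of _ "L * q1"])
        show "\<theta>' \<in> plane_multi_der K Z n'"
          unfolding \<theta>'_def using basis by (intro plane_multi_der_comb Kr L S) (auto simp: det_basis_def)
        show "line_der z \<theta>' = L * q1 * L ^ n' z"
          unfolding \<theta>'_def line_der_comb q by simp
        show "L * q1 \<in> polys K 2" by (intro S L q)
        show "restrict_line z (L * q1) = 0" by (simp add: L_def eval2_mult restrict_line_form)
      qed
      show "\<eta> \<in> plane_multi_der K Z n" by fact
      have "der_det \<theta>' \<eta> = L * der_det \<theta> \<eta>" by (simp add: der_det_def \<theta>'_def algebra_simps)
      then show "der_det \<theta>' \<eta> \<noteq> 0" using basis L by (simp add: det_basis_def)
      fix \<zeta> assume "\<zeta> \<in> plane_multi_der K Z n"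
      then have \<zeta>: "\<zeta> \<in> plane_multi_der K Z n'" "\<exists>q\<in>polys K 2. line_der z \<zeta> = q * L ^ n z"
        unfolding mem by auto
      obtain a b where ab: "a \<in> polys K 2" "b \<in> polys K 2" "\<zeta> = (\<lambda>i. a * \<theta> i + b * \<eta> i)"
        using basis \<zeta>(1) unfolding det_basis_def by blast
      obtain r where "line_der z \<zeta> = r * L ^ n z" using \<zeta>(2) by blast
      then have "(a * q1 + b * q2) * L ^ n' z = (r * L) * L ^ n' z"
        unfolding ab(3) line_der_comb q nz by (simp add: algebra_simps)
      then have "a * q1 + b * q2 = r * L" using L by simp
      then have "restrict_line z (a * q1 + b * q2) = restrict_line z (r * L)" by simp
      then have "restrict_line z a = 0" using False q by (simp add: eval2_simps L_def restrict_line_form)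
      then obtain a' where "a' \<in> polys K 2" "a = L * a'"
        using line_form_dvd_iff[OF Kr zK ab(1)] unfolding L_def by blast
      then show "\<exists>a\<in>polys K 2. \<exists>b\<in>polys K 2. \<zeta> = (\<lambda>i. a * \<theta>' i + b * \<eta> i)"
        using ab by (intro bexI[of _ a'] bexI[of _ b]) (auto simp: \<theta>'_def mult_ac)
    qed
    then show ?thesis by blast
  qed
qed

section \<open>Arrangements of lines in the plane\<close>

text \<open>The coefficient vector of $x_0 - z x_1$.\<close>

definition line_vec :: "'k::field_char_0 \<Rightarrow> nat \<Rightarrow> 'k" where
  "line_vec z = (\<lambda>i. if i = 0 then 1 else if i = 1 then - z else 0)"

text \<open>The line $x_0 = z x_1$ in $K^2$.\<close>

definition line :: "'k::field_char_0 set \<Rightarrow> 'k \<Rightarrow> (nat \<Rightarrow> 'k) set" where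
  "line K z = form_kernel K 2 (line_vec z)"

lemma sum_lessThan_2: "(\<Sum>i<2. u i) = u 0 + u (1::nat)"
  by (simp add: numeral_2_eq_2)

lemma partial_deriv_add: "partial_deriv i (p + q) = partial_deriv i p + partial_deriv i q"
  unfolding partial_deriv_def
  by (rule setsum_keys_plus_distrib) (simp_all add: distrib_left single_add)

lemma partial_deriv_single:
  "partial_deriv i (single t c) = single (t - single i 1) (of_nat (lookup t i) * c)"
  by (simp add: partial_deriv_def)

lemma partial_deriv_linear_form:
  assumes "i < 2"
  shows "partial_deriv i (linear_form 2 a) = pconst (a i)"
proof -
  have "pconst c * pvar j = single (single j 1) c" for c :: 'a and j
    by (simp add: pconst_def pvar_def mult_single)
  moreover have "partial_deriv i (single (single j 1) c) = (if i = j then pconst c else 0)" for c :: 'a and j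
    by (simp add: partial_deriv_single lookup_single pconst_def)
  ultimately show ?thesis using assms
    by (auto simp: linear_form_def sum_lessThan_2 partial_deriv_add less_2_cases_iff)
qed

lemma der_apply_linear_form:
  "der_apply 2 \<theta> (linear_form 2 a) = pconst (a 0) * \<theta> 0 + pconst (a 1) * \<theta> 1"
  by (simp add: der_apply_def sum_lessThan_2 partial_deriv_linear_form mult.commute)

lemma line_vec_in_vecs: "is_subring K \<Longrightarrow> z \<in> K \<Longrightarrow> line_vec z \<in> vecs K 2"
  using is_subringD[of K] by (auto simp: vecs_def line_vec_def)

lemma mem_line: "v \<in> line K z \<longleftrightarrow> v \<in> vecs K 2 \<and> v 0 = z * v 1"
  by (auto simp: line_def form_kernel_def line_vec_def sum_lessThan_2 algebra_simps)

text \<open>A nonzero point of the line with parameter $z$.\<close>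

definition line_point :: "'k::field_char_0 \<Rightarrow> nat \<Rightarrow> 'k" where
  "line_point z = (\<lambda>i. if i = 0 then z else if i = 1 then 1 else 0)"

lemma line_point_mem: "is_subring K \<Longrightarrow> w \<in> K \<Longrightarrow> line_point w \<in> line K z \<longleftrightarrow> w = z"
  using is_subringD[of K] by (auto simp: mem_line vecs_def line_point_def)

text \<open>Whichever form was chosen for the line, it is a nonzero multiple of $x_0 - z x_1$.\<close>

lemma alpha_line:
  fixes K :: "'k::field_char_0 set"
  assumes K: "is_subring K" and z: "z \<in> K"
  obtains k where "k \<in> K" "k \<noteq> 0" "alpha K 2 (line K z) = pconst k * line_form z"
    "\<And>\<theta>. der_apply 2 \<theta> (alpha K 2 (line K z)) = pconst k * line_der z \<theta>"
proof -
  define a where "a = (SOME a. a \<in> vecs K 2 \<and> form_kernel K 2 a = line K z)"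
  have "\<exists>a. a \<in> vecs K 2 \<and> form_kernel K 2 a = line K z"
    using line_vec_in_vecs[OF K z] line_def by blast
  then have a: "a \<in> vecs K 2" "form_kernel K 2 a = line K z"
    unfolding a_def by (metis (mono_tags, lifting) someI_ex)+
  have "line_point z \<in> form_kernel K 2 a" unfolding a using line_point_mem[OF K z] by simp
  then have a1: "a 1 = - a 0 * z"
    by (simp add: form_kernel_def sum_lessThan_2 line_point_def algebra_simps eq_neg_iff_add_eq_0)
  have a0: "a 0 \<noteq> 0"
  proof
    assume "a 0 = 0"
    then have "line_point (z + 1) \<in> form_kernel K 2 a"
      using a1 is_subringD[OF K] z
      by (auto simp: form_kernel_def sum_lessThan_2 line_point_def vecs_def)
    then show False unfolding a using line_point_mem[OF K] is_subringD[OF K] z by fastforce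
  qed
  have alpha: "alpha K 2 (line K z) = linear_form 2 a" by (simp add: alpha_def a_def)
  have m: "pconst (a 1) = - (pconst (a 0) * pconst z)"
    unfolding a1 pconst_mult[symmetric] by (simp add: pconst_def single_uminus)
  show ?thesis
  proof (rule that)
    show "a 0 \<in> K" using a(1) by (simp add: vecs_def)
    show "a 0 \<noteq> 0" by fact
    show "alpha K 2 (line K z) = pconst (a 0) * line_form z"
      unfolding alpha linear_form_def line_form_def sum_lessThan_2 m by (simp add: algebra_simps)
    show "der_apply 2 \<theta> (alpha K 2 (line K z)) = pconst (a 0) * line_der z \<theta>" for \<theta>
      unfolding alpha der_apply_linear_form line_der_def m by (simp add: algebra_simps)
  qed
qed

lemma multi_der_lines:
  fixes K :: "'k::field_char_0 set"
  assumes K: "is_subfield K" and Z: "Z \<subseteq> K"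
  shows "multi_der K 2 (line K ` Z) m = plane_multi_der K Z (\<lambda>z. m (line K z))"
proof -
  note Kr = is_subfieldD(1)[OF K]
  note S = is_subringD[OF is_subring_polys[OF Kr, of 2]]
  have "(\<exists>q\<in>polys K 2. der_apply 2 \<theta> (alpha K 2 (line K z)) = q * alpha K 2 (line K z) ^ n)
    \<longleftrightarrow> (\<exists>q\<in>polys K 2. line_der z \<theta> = q * line_form z ^ n)" if z: "z \<in> Z" for z \<theta> n
  proof -
    obtain k where k: "k \<in> K" "k \<noteq> 0" "alpha K 2 (line K z) = pconst k * line_form z"
      "\<And>\<theta>. der_apply 2 \<theta> (alpha K 2 (line K z)) = pconst k * line_der z \<theta>"
      by (rule alpha_line[OF Kr, of z]) (use z Z in auto)
    define k' where "k' = inverse k"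
    have k': "k' \<in> K" "pconst k' * pconst k = 1"
      using k(1,2) is_subfieldD[OF K] by (simp_all add: k'_def pconst_mult[symmetric] pconst_1)
    have pk: "pconst k \<in> polys K 2" "pconst k' \<in> polys K 2" using k k' by (auto intro: pconst_in_polys)
    have kn: "pconst k' ^ n * pconst k ^ n = 1" using k'(2) by (metis power_mult_distrib power_one)
    show ?thesis
    proof
      assume "\<exists>q\<in>polys K 2. der_apply 2 \<theta> (alpha K 2 (line K z)) = q * alpha K 2 (line K z) ^ n"
      then obtain q where q: "q \<in> polys K 2" "pconst k * line_der z \<theta> = q * (pconst k * line_form z) ^ n"
        unfolding k(4) unfolding k(3) by blast
      have "line_der z \<theta> = (pconst k' * pconst k) * line_der z \<theta>" using k' by simp
      also have "\<dots> = (pconst k' * q * pconst k ^ n) * line_form z ^ n"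
        unfolding mult.assoc q(2) by (simp add: power_mult_distrib mult_ac)
      finally have "line_der z \<theta> = (pconst k' * q * pconst k ^ n) * line_form z ^ n" .
      moreover have "pconst k' * q * pconst k ^ n \<in> polys K 2" by (intro S pk q)
      ultimately show "\<exists>q\<in>polys K 2. line_der z \<theta> = q * line_form z ^ n" by blast
    next
      assume "\<exists>q\<in>polys K 2. line_der z \<theta> = q * line_form z ^ n"
      then obtain q where q: "q \<in> polys K 2" "line_der z \<theta> = q * line_form z ^ n" by blast
      have "pconst k * line_der z \<theta> = (pconst k * q * (pconst k' ^ n * pconst k ^ n)) * line_form z ^ n"
        unfolding kn q by simp
      also have "\<dots> = (pconst k * q * pconst k' ^ n) * (pconst k * line_form z) ^ n"
        by (simp add: power_mult_distrib mult_ac)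
      finally have "pconst k * line_der z \<theta> = (pconst k * q * pconst k' ^ n) * (pconst k * line_form z) ^ n" .
      moreover have "pconst k * q * pconst k' ^ n \<in> polys K 2" by (intro S pk q)
      ultimately show "\<exists>q\<in>polys K 2. der_apply 2 \<theta> (alpha K 2 (line K z)) = q * alpha K 2 (line K z) ^ n"
        unfolding k(4) unfolding k(3) by blast
    qed
  qed
  then show ?thesis by (simp add: multi_der_def plane_multi_der_def)
qed

lemma totally_free_lines:
  assumes "is_subfield K" "finite Z" "Z \<subseteq> K"
  shows "totally_free K 2 (line K ` Z)"
  using assms plane_multi_der_basis det_basis_imp_free_module[OF is_subfieldD(1)]
  by (fastforce simp: totally_free_def free_multiarrangement_def multi_der_lines)

lemma essential_lines:
  assumes K: "is_subring K" and Z: "finite Z" "Z \<subseteq> K" "z1 \<in> Z" "z2 \<in> Z" "z1 \<noteq> z2"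
  shows "essential_arrangement K 2 (line K ` Z)"
  unfolding essential_arrangement_def
proof (intro conjI ballI)
  show "finite (line K ` Z)" using Z by simp
  show "linear_hyperplane K 2 H" if H: "H \<in> line K ` Z" for H
  proof -
    obtain z where "z \<in> Z" "H = line K z" using H by blast
    moreover have "line_vec z \<noteq> (\<lambda>_. 0)" by (auto simp: line_vec_def fun_eq_iff)
    ultimately show ?thesis 
      using line_vec_in_vecs[OF K] Z(2) by (auto simp: linear_hyperplane_def line_def)
  qed
  show "vecs K 2 \<inter> \<Inter> (line K ` Z) = {\<lambda>_. 0}"
  proof (intro equalityI subsetI)
    fix v assume v: "v \<in> vecs K 2 \<inter> \<Inter> (line K ` Z)"
    then have "v \<in> line K z1" "v \<in> line K z2" using Z by auto
    then have "v 0 = z1 * v 1" "v 0 = z2 * v 1" by (simp_all add: mem_line)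
    then have "v 0 = 0" "v 1 = 0" using Z(5) by auto
    moreover have "v i = 0" if "i \<ge> 2" for i using v that by (simp add: vecs_def)
    ultimately have "v i = 0" for i by (metis One_nat_def less_2_cases not_le)
    then show "v \<in> {\<lambda>_. 0}" by auto
  next
    fix v :: "nat \<Rightarrow> 'a" assume "v \<in> {\<lambda>_. 0}"
    then show "v \<in> vecs K 2 \<inter> \<Inter> (line K ` Z)"
      using is_subringD[OF K] by (auto simp: mem_line vecs_def)
  qed
qed

section \<open>Universal derivations\<close>

text \<open>Here $f/g$ is a map fixing the points of $Z$ to the order prescribed by $n$. The divisibility hypotheses for
  all pairs bound the order of the Wronskian at each point of $Z$ by $n$ and exclude other
  roots. The fixed point equations give the opposite bound, and one more order at a point where
  $g$ vanishes too.\<close>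

lemma wronskian_factorization:
  fixes f g :: "complex poly"
  defines "W \<equiv> wronskian f g"
  assumes Z: "finite Z" and z12: "z1 \<in> Z" "z2 \<in> Z" "z1 \<noteq> z2"
    and fixed: "\<And>z. z \<in> Z \<Longrightarrow> \<exists>p. f = smult z g + [:-z, 1:] ^ (n z + 1) * p"
    and Wnz: "W \<noteq> 0"
    and W_dvd: "\<And>z w. z \<in> Z \<Longrightarrow> w \<in> Z \<Longrightarrow> z \<noteq> w \<Longrightarrow>
      W dvd (\<Prod>v\<in>Z - {z}. [:-v, 1:] ^ n v) * (\<Prod>v\<in>Z - {w}. [:-v, 1:] ^ n v)"
  shows "W = smult (lead_coeff W) (\<Prod>z\<in>Z. [:-z, 1:] ^ n z)"
    and "\<And>z. z \<in> Z \<Longrightarrow> poly g z \<noteq> 0"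
proof -
  define q where "q = (\<lambda>z. \<Prod>w\<in>Z - {z}. [:-w, 1:] ^ n w)"
  have qnz: "q z \<noteq> 0" for z using Z by (simp add: q_def)
  have order_q: "order w (q z) = (if w \<in> Z - {z} then n w else 0)" for w z
  proof -
    have lin: "proots ([:-v, 1:] ^ n v) = repeat_mset (n v) {#v#}" for v
      using proots_linear_factor[of "-v"] by (simp add: proots_power)
    have "proots (q z) = (\<Sum>v\<in>Z - {z}. proots ([:-v, 1:] ^ n v))"
      unfolding q_def by (intro proots_prod) simp
    then have "order w (q z) = (\<Sum>v\<in>Z - {z}. if w = v then n v else 0)"
      unfolding count_proots[OF qnz, symmetric] lin by (simp add: count_sum)
    also have "\<dots> = (if w \<in> Z - {z} then n w else 0)" using Z by (subst sum.delta') auto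
    finally show ?thesis .
  qed
  have upper: "order z W \<le> (if z \<in> Z then n z else 0)" for z
  proof -
    obtain w v where wv: "w \<in> Z" "v \<in> Z" "w \<noteq> v" and z: "z \<in> Z \<Longrightarrow> z = w"
      using z12 by (cases "z \<in> Z") metis+
    have "order z W \<le> order z (q w * q v)"
      using W_dvd[OF wv] qnz by (intro dvd_imp_order_le) (auto simp: q_def)
    also have "\<dots> = order z (q w) + order z (q v)" using qnz by (intro order_mult) simp
    also have "\<dots> = (if z \<in> Z then n z else 0)" using z wv by (auto simp: order_q)
    finally show ?thesis .
  qed
  have lower: "[:-z, 1:] ^ (if poly g z = 0 then n z + 1 else n z) dvd W" if z: "z \<in> Z" for z
  proof -
    obtain p where p: "f = smult z g + [:-z, 1:] ^ (n z + 1) * p" using fixed[OF z] by blast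
    define L where "L = [:-z, 1:]"
    have "pderiv L = 1" by (simp add: L_def pderiv_pCons)
    then have "pderiv (L ^ Suc (n z) * p) = L ^ n z * (smult (of_nat (Suc (n z))) p + L * pderiv p)"
      unfolding pderiv_mult pderiv_power_Suc by (simp add: algebra_simps del: of_nat_Suc)
    moreover have "W = wronskian (L ^ Suc (n z) * p) g"
      using wronskian_combine_left[of 1 "L ^ Suc (n z) * p" z g] p
      by (simp add: W_def L_def add.commute)
    ultimately have W: "W = L ^ n z * (smult (of_nat (n z + 1)) p + L * pderiv p) * g - L ^ (n z + 1) * p * pderiv g"
      by (simp add: wronskian_def)
    show ?thesis
    proof (cases "poly g z = 0")
      case True
      then obtain g' where g': "g = L * g'" unfolding L_def by (metis poly_eq_0_iff_dvd dvdE)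
      have "L ^ n z * (smult (of_nat (n z + 1)) p + L * pderiv p) * g 
          = L ^ (n z + 1) * ((smult (of_nat (n z + 1)) p + L * pderiv p) * g')"
        unfolding g' by (simp only: power_add power_one_right mult_ac)
      then have "L ^ (n z + 1) dvd W" unfolding W mult.assoc by (metis dvd_diff dvd_triv_left mult.assoc)
      then show ?thesis using True by (simp add: L_def)
    next
      case False
      have "L ^ n z dvd W" unfolding W power_add mult.assoc by (intro dvd_diff dvd_triv_left)
      then show ?thesis using False by (simp add: L_def)
    qed
  qed
  show gnz: "poly g z \<noteq> 0" if "z \<in> Z" for z
    using lower[OF that] upper[of z] that Wnz by (auto simp: order_divides split: if_splits)
  have order_W: "order z W = n z" if z: "z \<in> Z" for z
    using lower[OF z] upper[of z] z Wnz gnz[OF z] by (auto simp: order_divides split: if_splits)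
  show "W = smult (lead_coeff W) (\<Prod>z\<in>Z. [:-z, 1:] ^ n z)"
  proof -
    have "(\<Prod>z\<in>Z. [:-z, 1:] ^ n z) = (\<Prod>z | poly W z = 0. [:-z, 1:] ^ order z W)"
    proof (rule prod.mono_neutral_cong_right)
      show roots: "{z. poly W z = 0} \<subseteq> Z"
      proof
        fix z assume "z \<in> {z. poly W z = 0}"
        then have "order z W \<noteq> 0" using Wnz by (simp add: order_root)
        then show "z \<in> Z" using upper[of z] by (auto split: if_splits)
      qed
      show "\<forall>z\<in>Z - {z. poly W z = 0}. [:-z, 1:] ^ n z = 1"
      proof
        fix z assume "z \<in> Z - {z. poly W z = 0}"
        then have "n z = 0" using order_W[of z] order_0I[of W z] by simp
        then show "[:-z, 1:] ^ n z = 1" by simp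
      qed
      show "[:-z, 1:] ^ n z = [:-z, 1:] ^ order z W" if "z \<in> {z. poly W z = 0}" for z
        using order_W[of z] roots that by auto
    qed (use Z in auto)
    then show ?thesis using complex_poly_decompose[of W] by simp
  qed
qed

text \<open>Write $\theta = f \partial_0 + g \partial_1$ with $f, g$ of degree $d$. For $z \in Z$ the module
  $D(\mathscr{A},m)$ contains the derivation $Q_z (z \partial_0 + \partial_1)$, where
  $Q_z = \prod_{w \ne z} (x_0 - w x_1)^{n(w)}$. Two of these are combinations of the columns of the
  Jacobian matrix of $\theta$, so the Jacobian divides $Q_z Q_w$. The entries of the Jacobian matrix
  have degree $d - 1$, which gives $d - 1 \le \deg Q_z$.\<close>

lemma universal_der_univariate:
  fixes K :: "complex set"
  assumes K: "is_subfield K" and Z: "finite Z" "Z \<subseteq> K" and z12: "z1 \<in> Z" "z2 \<in> Z" "z1 \<noteq> z2"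
    and univ: "universal_der K 2 (line K ` Z) m \<theta>"
  defines "n \<equiv> \<lambda>z. m (line K z)"
  obtains f g c d where "f \<in> polys_over K" "g \<in> polys_over K" "degree f \<le> d" "degree g \<le> d" "c \<noteq> 0"
    "wronskian f g = smult c (\<Prod>z\<in>Z. [:-z, 1:] ^ n z)"
    "\<And>z. z \<in> Z \<Longrightarrow> poly f z = z * poly g z" "\<And>z. z \<in> Z \<Longrightarrow> poly g z \<noteq> 0"
    "\<And>z. z \<in> Z \<Longrightarrow> d \<le> (\<Sum>w\<in>Z - {z}. n w) + 1"
proof -
  note Kr = is_subfieldD(1)[OF K]
  note S = is_subringD[OF is_subring_polys[OF Kr, of 2]]
  have \<theta>: "\<theta> \<in> plane_multi_der K Z (\<lambda>z. n z + 1)"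
    using univ multi_der_lines[OF K Z(2), of "\<lambda>H. m H + 1"] by (simp add: universal_der_def n_def)
  obtain d where hom: "homogeneous_der K 2 d \<theta>" using univ by (auto simp: universal_der_def)
  have surj: "\<exists>\<phi>\<in>Der K 2. nabla 2 \<phi> \<theta> = \<eta>" if "\<eta> \<in> plane_multi_der K Z n" for \<eta>
  proof -
    have "\<eta> \<in> multi_der K 2 (line K ` Z) m" using that multi_der_lines[OF K Z(2), of m] by (simp add: n_def)
    then have "\<eta> \<in> (\<lambda>\<phi>. nabla 2 \<phi> \<theta>) ` Der K 2"
      using univ by (simp add: universal_der_def module_iso_def bij_betw_def)
    then show ?thesis by blast
  qed
  have nabla: "nabla 2 \<phi> \<theta> i = \<phi> 0 * partial_deriv 0 (\<theta> i) + \<phi> 1 * partial_deriv 1 (\<theta> i)" for \<phi> i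
    by (simp add: nabla_def der_apply_def sum_lessThan_2)
  have poly: "\<theta> 0 \<in> polys K 2" "\<theta> 1 \<in> polys K 2" using \<theta> by (auto simp: plane_multi_der_def Der_def)
  have homog: "homogeneous_poly d (\<theta> i)" if "i < 2" for i
  proof -
    define a where "a = (\<lambda>j. if j = i then 1 else 0 :: complex)"
    have "a \<in> vecs K 2" using is_subringD[OF Kr] that by (auto simp: a_def vecs_def)
    moreover have "der_apply 2 \<theta> (linear_form 2 a) = \<theta> i"
      using that unfolding der_apply_linear_form by (auto simp: a_def less_2_cases_iff pconst_0 pconst_1)
    ultimately have "\<theta> i \<noteq> 0 \<longrightarrow> homogeneous_poly d (\<theta> i)" using hom by (auto simp: homogeneous_der_def)
    then show ?thesis by (cases "\<theta> i = 0") (auto simp: homogeneous_poly_def)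
  qed
  have h: "homogeneous_poly d (\<theta> 0)" "homogeneous_poly d (\<theta> 1)" using homog by auto
  define f where "f = dehom (\<theta> 0)"
  define g where "g = dehom (\<theta> 1)"
  define W where "W = wronskian f g"
  have fg: "f \<in> polys_over K" "g \<in> polys_over K"
    unfolding f_def g_def using poly is_subringD[OF Kr] is_subringD[OF is_subring_polys_over[OF Kr]]
    by (auto intro!: eval2_in_polys_over[OF Kr] polys_over_pCons)
  have deg: "degree f \<le> d" "degree g \<le> d"
    unfolding f_def g_def using degree_dehom_le poly h by blast+
  have dL: "dehom (line_form z) = [:-z, 1:]" for z :: complex
    by (simp add: line_form_def eval2_simps)
  define Q where "Q = (\<lambda>z. \<Prod>w\<in>Z - {z}. line_form w ^ n w)"
  define q where "q = (\<lambda>z. \<Prod>w\<in>Z - {z}. [:-w, 1:] ^ n w)"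
  have dQ: "dehom (Q z) = q z" for z by (simp add: Q_def q_def eval2_prod eval2_power dL)
  have "\<exists>\<phi> :: complex deriv. \<phi> 0 * partial_deriv 0 (\<theta> 0) + \<phi> 1 * partial_deriv 1 (\<theta> 0) = pconst z * Q z \<and>
      \<phi> 0 * partial_deriv 0 (\<theta> 1) + \<phi> 1 * partial_deriv 1 (\<theta> 1) = Q z" if z: "z \<in> Z" for z
  proof -
    \<comment> \<open>the derivation $Q_z (z \partial_0 + \partial_1)$, which kills $x_0 - z x_1$\<close>
    define \<eta> where "\<eta> = (\<lambda>i::nat. if i = 0 then pconst z * Q z else if i = 1 then Q z else 0)"
    have L: "line_form w \<in> polys K 2" if "w \<in> Z" for w using line_form_in_polys[OF Kr] that Z by blast
    have prod: "(\<Prod>w\<in>A. line_form w ^ n w) \<in> polys K 2" if "A \<subseteq> Z" for A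
      using that by (induction A rule: infinite_finite_induct) (auto intro!: S L)
    have zK: "pconst z \<in> polys K 2" using z Z by (auto intro: pconst_in_polys)
    have "\<exists>p\<in>polys K 2. line_der w \<eta> = p * line_form w ^ n w" if w: "w \<in> Z" for w
    proof (cases "w = z")
      case True
      have "line_der w \<eta> = 0" using True by (simp add: line_der_def \<eta>_def)
      then show ?thesis by (intro bexI[of _ 0] S) simp
    next
      case False
      have "Q z = line_form w ^ n w * (\<Prod>w\<in>Z - {z} - {w}. line_form w ^ n w)"
        unfolding Q_def using False w Z(1) by (intro prod.remove) auto
      then have "line_der w \<eta> = (pconst z - pconst w) * (\<Prod>w\<in>Z - {z} - {w}. line_form w ^ n w) * line_form w ^ n w"
        by (simp add: line_der_def \<eta>_def algebra_simps)
      moreover have "(pconst z - pconst w) * (\<Prod>w\<in>Z - {z} - {w}. line_form w ^ n w) \<in> polys K 2"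
        using w Z by (intro S prod zK pconst_in_polys) auto
      ultimately show ?thesis by blast
    qed
    moreover have "\<eta> \<in> Der K 2"
      using prod[of "Z - {z}"] zK by (auto simp: Der_def \<eta>_def Q_def intro: S)
    ultimately have "\<eta> \<in> plane_multi_der K Z n" by (simp add: plane_multi_der_def)
    then obtain \<phi> where "\<phi> \<in> Der K 2" "nabla 2 \<phi> \<theta> = \<eta>" using surj by blast
    then show ?thesis using nabla[of \<phi> 0] nabla[of \<phi> 1] by (intro exI[of _ \<phi>]) (simp add: \<eta>_def)
  qed
  then have "\<forall>z\<in>Z. \<exists>\<phi> :: complex deriv. \<phi> 0 * partial_deriv 0 (\<theta> 0) + \<phi> 1 * partial_deriv 1 (\<theta> 0) = pconst z * Q z \<and>
      \<phi> 0 * partial_deriv 0 (\<theta> 1) + \<phi> 1 * partial_deriv 1 (\<theta> 1) = Q z" by blast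
  from bchoice[OF this] obtain \<Phi> :: "complex \<Rightarrow> complex deriv" where
    \<Phi>: "\<And>z. z \<in> Z \<Longrightarrow> \<Phi> z 0 * partial_deriv 0 (\<theta> 0) + \<Phi> z 1 * partial_deriv 1 (\<theta> 0) = pconst z * Q z"
    "\<And>z. z \<in> Z \<Longrightarrow> \<Phi> z 0 * partial_deriv 0 (\<theta> 1) + \<Phi> z 1 * partial_deriv 1 (\<theta> 1) = Q z" by blast
  have W_dvd: "W \<noteq> 0 \<and> W dvd q z * q w" if z: "z \<in> Z" "w \<in> Z" "z \<noteq> w" for z w
  proof -
    define A where "A = (\<lambda>z. dehom (\<Phi> z 0))"
    define B where "B = (\<lambda>z. dehom (\<Phi> z 1))"
    define X :: "complex poly" where "X = [:0, 1:]"
    have e0: "A z * pderiv f + B z * (smult (of_nat d) f - X * pderiv f) = smult z (q z)" if "z \<in> Z" for z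
      using arg_cong[OF \<Phi>(1)[OF that], of dehom] dehom_partial_deriv_1[OF poly(1) h(1)]
      by (simp add: eval2_simps dQ dehom_partial_deriv_0 f_def A_def B_def X_def)
    have e1: "A z * pderiv g + B z * (smult (of_nat d) g - X * pderiv g) = q z" if "z \<in> Z" for z
      using arg_cong[OF \<Phi>(2)[OF that], of dehom] dehom_partial_deriv_1[OF poly(2) h(2)]
      by (simp add: eval2_simps dQ dehom_partial_deriv_0 g_def A_def B_def X_def)
    \<comment> \<open>Euler's identity turns the Jacobian into $d$ times the Wronskian; the determinant is multiplicative.\<close>
    have "smult (of_nat d) W * (A z * B w - A w * B z)
       = (A z * pderiv f + B z * (smult (of_nat d) f - X * pderiv f))
         * (A w * pderiv g + B w * (smult (of_nat d) g - X * pderiv g))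
       - (A z * pderiv g + B z * (smult (of_nat d) g - X * pderiv g))
         * (A w * pderiv f + B w * (smult (of_nat d) f - X * pderiv f))"
      by (simp add: W_def wronskian_def algebra_simps smult_diff_right)
    also have "\<dots> = smult (z - w) (q z * q w)"
      unfolding e0[OF z(1)] e0[OF z(2)] e1[OF z(1)] e1[OF z(2)] by (simp add: smult_diff_left mult.commute)
    finally have eq: "smult (of_nat d) W * (A z * B w - A w * B z) = smult (z - w) (q z * q w)" .
    have qnz: "q z * q w \<noteq> 0" using Z(1) by (simp add: q_def)
    have "W * smult (of_nat d) (A z * B w - A w * B z) = smult (z - w) (q z * q w)" using eq by simp
    then have "W dvd smult (z - w) (q z * q w)" by (metis dvd_triv_left)
    then have "W dvd q z * q w" using z(3) by (simp add: dvd_smult_iff)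
    moreover have "W \<noteq> 0"
    proof
      assume "W = 0"
      then have "smult (z - w) (q z * q w) = 0" using eq by simp
      then show False using qnz z(3) by simp
    qed
    ultimately show ?thesis by blast
  qed
  have fixed: "\<exists>p. f = smult z g + [:-z, 1:] ^ (n z + 1) * p" if z: "z \<in> Z" for z
  proof -
    obtain p where "line_der z \<theta> = p * line_form z ^ (n z + 1)"
      using \<theta> z unfolding plane_multi_der_def by blast
    from arg_cong[OF this, of dehom] have "f - smult z g = dehom p * [:-z, 1:] ^ (n z + 1)"
      by (simp add: line_der_def eval2_simps dL f_def g_def)
    then have "f = smult z g + [:-z, 1:] ^ (n z + 1) * dehom p" by (simp add: algebra_simps)
    then show ?thesis ..
  qed
  have Wnz: "W \<noteq> 0" using W_dvd[OF z12] by simp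
  note factor = wronskian_factorization[OF Z(1) z12 fixed Wnz[unfolded W_def]]
  have "W = smult (lead_coeff W) (\<Prod>z\<in>Z. [:-z, 1:] ^ n z)"
    unfolding W_def using W_dvd by (intro factor) (auto simp: W_def q_def)
  moreover have gnz: "poly g z \<noteq> 0" if "z \<in> Z" for z
    using W_dvd that by (intro factor(2)) (auto simp: W_def q_def)
  moreover have "poly f z = z * poly g z" if z: "z \<in> Z" for z
  proof -
    obtain p where p: "f = smult z g + [:-z, 1:] ^ (n z + 1) * p" using fixed[OF z] by blast
    show ?thesis unfolding p by simp
  qed
  moreover have "d \<le> (\<Sum>w\<in>Z - {z}. n w) + 1" if z: "z \<in> Z" for z
  proof -
    \<comment> \<open>On the line $x_1 = 0$, which is not in the arrangement, every form restricts to the coordinate $x_0$.\<close>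
    have "eval2 [:0, 1:] 0 (line_form w) = [:0, 1:]" for w :: complex by (simp add: line_form_def eval2_simps)
    then have e: "eval2 [:0, 1:] 0 (Q z) = [:0, 1:] ^ (\<Sum>w\<in>Z - {z}. n w)"
      by (simp add: Q_def eval2_prod eval2_power power_sum)
    have "[:0, 1:] ^ (d - 1) dvd eval2 [:0, 1:] 0 (Q z)"
      unfolding \<Phi>(2)[OF z, symmetric] eval2_add eval2_mult
      by (intro dvd_add dvd_mult dvd_eval2_partial_deriv[OF poly(2) h(2)])
    then have "degree ([:0, 1::complex:] ^ (d - 1)) \<le> degree ([:0, 1::complex:] ^ (\<Sum>w\<in>Z - {z}. n w))"
      unfolding e by (intro dvd_imp_degree_le) auto
    then show ?thesis by (simp add: degree_power_eq)
  qed
  ultimately show ?thesis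
    using that[of f g d "lead_coeff W"] fg deg Wnz gnz unfolding W_def by simp
qed

section \<open>Four lines with transcendental cross-ratio\<close>

theorem theorem1p8:
  shows "\<exists>(K :: complex set) (l :: nat) (A :: (nat \<Rightarrow> complex) set set).
    is_subfield K \<and> l \<ge> 1 \<and> essential_arrangement K l A \<and> totally_free K l A \<and>
    (\<forall>m :: (nat \<Rightarrow> complex) set \<Rightarrow> nat. (\<exists>H\<in>A. m H \<noteq> 0) \<longrightarrow>
       \<not> (\<exists>\<theta>. universal_der K l A m \<theta> \<and> \<theta> \<noteq> euler_der l))"
proof -
  obtain x :: complex where x: "\<not> algebraic x" using ex_transcendental by blast
  define K where "K = simple_ext x"
  define Z where "Z = {0, 1, 2, x}"
  have K: "is_subfield K" unfolding K_def by (rule is_subfield_simple_ext)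
  have Z: "finite Z" "Z \<subseteq> K"
    by (auto simp: Z_def K_def generator_in_simple_ext Ints_subset_simple_ext)
  have x_neq: "x \<noteq> 0" "x \<noteq> 1" "x \<noteq> 2" using x by auto
  have Z01: "0 \<in> Z" "1 \<in> Z" "0 \<noteq> (1 :: complex)" by (simp_all add: Z_def)
  have "\<not> universal_der K 2 (line K ` Z) m \<theta>" if m: "\<exists>H\<in>line K ` Z. m H \<noteq> 0" for m \<theta>
  proof
    assume univ: "universal_der K 2 (line K ` Z) m \<theta>"
    define n where "n = (\<lambda>z. m (line K z))"
    obtain f g c d where fg: "f \<in> polys_over K" "g \<in> polys_over K" "degree f \<le> d" "degree g \<le> d" "c \<noteq> 0"
      and W: "wronskian f g = smult c (\<Prod>z\<in>Z. [:-z, 1:] ^ n z)"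
      and fixed: "\<And>z. z \<in> Z \<Longrightarrow> poly f z = z * poly g z" "\<And>z. z \<in> Z \<Longrightarrow> poly g z \<noteq> 0"
      and d: "\<And>z. z \<in> Z \<Longrightarrow> d \<le> (\<Sum>w\<in>Z - {z}. n w) + 1"
      unfolding n_def by (rule universal_der_univariate[OF K Z Z01 univ]) blast
    have "(\<Prod>z\<in>Z. [:-z, 1:] ^ n z) = [:-0, 1:] ^ n 0 * [:-1, 1:] ^ n 1 * [:-2, 1:] ^ n 2 * [:-x, 1:] ^ n x"
      using x_neq by (simp add: Z_def mult_ac)
    with W have W': "wronskian f g = smult c ([:-0, 1:] ^ n 0 * [:-1, 1:] ^ n 1 * [:-2, 1:] ^ n 2 * [:-x, 1:] ^ n x)"
      by simp
    have "n 0 + n 1 + n 2 + n x < d"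
      by (rule fixed_ramification_bound_transcendental[OF x _ fg(3) _ fg(4) _ _ _ _ _ _ fg(5) W'])
        (use fg fixed in \<open>auto simp: K_def Z_def\<close>)
    moreover have "(\<Sum>z\<in>Z. n z) = n 0 + n 1 + n 2 + n x" using x_neq by (simp add: Z_def)
    moreover obtain z where z: "z \<in> Z" "n z \<noteq> 0" using m by (auto simp: n_def)
    moreover have "(\<Sum>w\<in>Z. n w) = n z + (\<Sum>w\<in>Z - {z}. n w)" using Z z by (intro sum.remove)
    ultimately show False using d[of z] by linarith
  qed
  moreover have "essential_arrangement K 2 (line K ` Z)"
    by (rule essential_lines[OF is_subfieldD(1)[OF K] Z Z01])
  ultimately show ?thesis
    using K totally_free_lines[OF K Z] by (intro exI[of _ K] exI[of _ 2] exI[of _ "line K ` Z"]) auto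
qed

end
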